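(* Let $\Sigma$ be any system of the form $$\dot x=g_0(x)+\sum_{i=1}^m u_i\,g_i(x),\qquad x\in\mathbb{R}^n,\ u=(u_1,\dots,u_m)\in\mathbb{R}^m,$$ where the vector fields $g_0,\dots,g_m:\mathbb{R}^n\to\mathbb{R}^n$ are locally Lipschitz. Then $$\inf\{\gamma \mid \mathcal{W}_\infty(\Sigma,\gamma)\neq\emptyset\}=\inf\left\{\gamma \mid \mathcal{W}_\infty(\Sigma,\gamma)\cap\mathcal{C}^1_0\neq\emptyset\right\}.$$
   Context: Notation: $|\cdot|$ is the Euclidean norm; $\gamma$ ranges over $\gamma\ge 0$, and the infimum of the empty set is $+\infty$. For $V:\mathbb{R}^n\to\mathbb{R}$ and $x\in\mathbb{R}^n$, the viscosity subdifferential $\partial_D V(x)$ is the (possibly empty) set of all $\zeta\in\mathbb{R}^n$ such that $$\liminf_{h\to 0}\frac{1}{|h|}\left[V(x+h)-V(x)-\zeta\cdot h\right]\ge 0 .$$ For a system $\Sigma:\ \dot x=F(x,u)$ with $x\in\mathbb{R}^n$, $u\in\mathcal{U}$, and $\gamma\ge 0$, $\mathcal{W}(\Sigma,\gamma)$ is the set of all continuous $V:\mathbb{R}^n\to\mathbb{R}_{\ge0}$ such that $$\zeta\cdot F(x,u)\le -|x|^2+\gamma|u|^2\quad\text{for all }x\in\mathbb{R}^n\setminus\{0\},\ u\in\mathcal{U},\ \zeta\in\partial_D V(x).$$ A continuous $V:\mathbb{R}^n\to\mathbb{R}_{\ge0}$ is proper if $\{x: V(x)\le a\}$ is compact for every $a>0$,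 and positive definite if $V(x)=0$ if and only if $x=0$. $\mathcal{W}_\infty(\Sigma,\gamma)$ is the set of $V\in\mathcal{W}(\Sigma,\gamma)$ that are proper and positive definite. $\mathcal{C}^1_0$ is the set of continuous functions $V:\mathbb{R}^n\to\mathbb{R}_{\ge0}$ whose restriction to $\mathbb{R}^n\setminus\{0\}$ is continuously differentiable. Here $\mathcal{U}=\mathbb{R}^m$. *)

theory Defs
  imports "HOL-Analysis.Analysis"
begin

text \<open>
  The library's \<^const>\<open>local_lipschitz\<close> is about time-dependent maps; an autonomous vector field is
  a map that ignores its (dummy) real time argument.
\<close>

abbreviation locally_lipschitz :: "('a::metric_space \<Rightarrow> 'b::metric_space) \<Rightarrow> bool" where
  "locally_lipschitz f \<equiv> local_lipschitz (UNIV :: real set) UNIV (\<lambda>_. f)"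

text \<open>The lower limit is taken in the extended reals, as it may be infinite.\<close>

definition viscosity_subdifferential :: "('a::euclidean_space \<Rightarrow> real) \<Rightarrow> 'a \<Rightarrow> 'a set" where
  "viscosity_subdifferential V x =
     {\<zeta>. Liminf (at 0) (\<lambda>h. ereal (1 / norm h * (V (x + h) - V x - \<zeta> \<bullet> h))) \<ge> 0}"

text \<open>
  A system is given by its right-hand side \<open>F\<close>; the input set is the whole space \<open>'u\<close>.
\<close>

definition storage_functions ::
    "('a::euclidean_space \<Rightarrow> 'u::euclidean_space \<Rightarrow> 'a) \<Rightarrow> real \<Rightarrow> ('a \<Rightarrow> real) set" where
  "storage_functions F \<gamma> =
     {V. continuous_on UNIV V \<and> (\<forall>x. 0 \<le> V x) \<and>
         (\<forall>x u. \<forall>\<zeta>\<in>viscosity_subdifferential V x.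
            x \<noteq> 0 \<longrightarrow> \<zeta> \<bullet> F x u \<le> - (norm x)\<^sup>2 + \<gamma> * (norm u)\<^sup>2)}"

definition proper_fun :: "('a::euclidean_space \<Rightarrow> real) \<Rightarrow> bool" where
  "proper_fun V \<longleftrightarrow> (\<forall>a>0. compact {x. V x \<le> a})"

definition positive_definite_fun :: "('a::euclidean_space \<Rightarrow> real) \<Rightarrow> bool" where
  "positive_definite_fun V \<longleftrightarrow> (\<forall>x. V x = 0 \<longleftrightarrow> x = 0)"

definition proper_storage_functions ::
    "('a::euclidean_space \<Rightarrow> 'u::euclidean_space \<Rightarrow> 'a) \<Rightarrow> real \<Rightarrow> ('a \<Rightarrow> real) set" where
  "proper_storage_functions F \<gamma> =
     {V \<in> storage_functions F \<gamma>. proper_fun V \<and> positive_definite_fun V}"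

definition C1_off_origin :: "('a::euclidean_space \<Rightarrow> real) set" where
  "C1_off_origin =
     {V. continuous_on UNIV V \<and> (\<forall>x. 0 \<le> V x) \<and>
         (\<exists>V' :: 'a \<Rightarrow> 'a \<Rightarrow>\<^sub>L real.
            (\<forall>x\<in>UNIV - {0}. (V has_derivative blinfun_apply (V' x)) (at x)) \<and>
            continuous_on (UNIV - {0}) V')}"

definition affine_system ::
    "(real^'n \<Rightarrow> real^'n) \<Rightarrow> ('m::finite \<Rightarrow> real^'n \<Rightarrow> real^'n) \<Rightarrow> real^'n \<Rightarrow> real^'m \<Rightarrow> real^'n" where
  "affine_system g\<^sub>0 g x u = g\<^sub>0 x + (\<Sum>i\<in>UNIV. (u $ i) *\<^sub>R g i x)"

end

theory Submission
  imports Defs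
begin

text \<open>
  Fix \<open>\<gamma> < \<gamma>'\<close> and a continuous storage function \<open>V\<close> with gain \<open>\<gamma>\<close>. On a compact shell around the origin,
  the Moreau envelope of \<open>V\<close> is uniformly close to \<open>V\<close>, semiconcave, and has at every point a
  supergradient that is a subgradient of \<open>V\<close> at a nearby point; hence it satisfies the dissipation
  inequality up to a small multiple of \<open>1 + |u|\<^sup>2\<close>. Semiconcavity bounds difference quotients from
  above uniformly, so the inequality survives mollification (no almost everywhere differentiability is
  needed). The smooth functions on the shells \<open>k - 2 \<le> ln |x| \<le> k + 2\<close> are interpolated; as they are
  all close to \<open>V\<close>, the derivative of the cut-off contributes only another small multiple of
  \<open>1 + |u|\<^sup>2\<close>. With a total error at most \<open>c (|x|\<^sup>2 + |u|\<^sup>2)\<close>, multiplication by \<open>1 / (1 - c)\<close> restores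
  the term \<open>- |x|\<^sup>2\<close> and turns the gain into \<open>(\<gamma> + c) / (1 - c)\<close>, which is \<open>\<gamma>'\<close> for a suitable \<open>c\<close>.
\<close>

section \<open>Viscosity subgradients\<close>

text \<open>A paraboloid touching \<open>V\<close> from below at \<open>x\<close> is enough: after
  division by \<open>norm h\<close> its quadratic term is \<open>C * norm h\<close>, which vanishes
  as \<open>h\<close> tends to 0. Minimisers in the Moreau envelope supply such paraboloids.\<close>

lemma viscosity_subdifferentialI:
  fixes V :: "'a::euclidean_space \<Rightarrow> real"
  assumes "\<And>y. V x + \<zeta> \<bullet> (y - x) - C * (norm (y - x))\<^sup>2 \<le> V y"
  shows "\<zeta> \<in> viscosity_subdifferential V x"
  unfolding viscosity_subdifferential_def mem_Collect_eq le_Liminf_iff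
proof (intro allI impI)
  fix y :: ereal assume "y < 0"
  \<comment> \<open>The lower limit is tested against extended reals, possibly minus infinity; a
    negative real in between reduces the claim to real arithmetic.\<close>
  then obtain e :: real where e: "y < ereal e" "e < 0"
    by (metis ereal_dense2 ereal_less(1) less_ereal.simps(1) zero_ereal_def)
  have "((\<lambda>h::'a. - C * norm h) \<longlongrightarrow> - C * norm (0::'a)) (at 0)"
    by (intro tendsto_intros)
  then have "\<forall>\<^sub>F h::'a in at 0. e < - C * norm h"
    using e(2) order_tendstoD(1) by fastforce
  moreover have "\<forall>\<^sub>F h::'a in at 0. h \<noteq> 0"
    by (simp add: eventually_at_filter)
  ultimately show "\<forall>\<^sub>F h in at 0. y < ereal (1 / norm h * (V (x + h) - V x - \<zeta> \<bullet> h))"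
  proof eventually_elim
    case (elim h)
    have "- C * (norm h)\<^sup>2 \<le> V (x + h) - V x - \<zeta> \<bullet> h"
      using assms[of "x + h"] by simp
    then have "- C * norm h \<le> 1 / norm h * (V (x + h) - V x - \<zeta> \<bullet> h)"
      using elim(2) by (simp add: field_simps power2_eq_square)
    then have "ereal e < ereal (1 / norm h * (V (x + h) - V x - \<zeta> \<bullet> h))"
      using elim(1) by simp
    with e(1) show ?case by (rule less_trans)
  qed
qed

text \<open>Only quotients with \<open>t > 0\<close> are kept, because the estimates to be compared
  with derivatives are inequalities that get divided by \<open>t\<close>.\<close>

lemma has_derivative_ray:
  fixes V :: "'a::real_normed_vector \<Rightarrow> real"
  assumes V: "(V has_derivative D) (at x)"
  shows "((\<lambda>t. (V (x + t *\<^sub>R v) - V x) / t) \<longlongrightarrow> D v) (at_right 0)"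
proof -
  have "((\<lambda>t. V (x + t *\<^sub>R v)) has_derivative (\<lambda>t. D (t *\<^sub>R v))) (at 0)"
    using V by (intro has_derivative_compose[of "\<lambda>t. x + t *\<^sub>R v" _ _ _ V])
      (auto intro!: derivative_eq_intros)
  moreover have "D (t *\<^sub>R v) = D v * t" for t
    using has_derivative_bounded_linear[OF V] by (simp add: bounded_linear.linear linear_scale mult.commute)
  ultimately have "((\<lambda>t. V (x + t *\<^sub>R v)) has_real_derivative D v) (at 0)"
    by (simp add: has_field_derivative_def)
  then show ?thesis
    unfolding DERIV_def by (auto intro: tendsto_mono[OF at_le])
qed

text \<open>Along the ray \<open>t *\<^sub>R v\<close> the subgradient condition bounds the
  difference quotients from below by \<open>\<zeta> \<bullet> v - e * norm v\<close> for small
  \<open>t\<close>, and these quotients converge to \<open>D v\<close>. For a smooth function the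
  viscosity inequality thus follows from one on the ordinary derivative.\<close>

lemma viscosity_subdifferential_le_derivative:
  fixes V :: "'a::euclidean_space \<Rightarrow> real"
  assumes V: "(V has_derivative D) (at x)" and \<zeta>: "\<zeta> \<in> viscosity_subdifferential V x"
  shows "\<zeta> \<bullet> v \<le> D v"
proof (cases "v = 0")
  case True
  then show ?thesis using has_derivative_bounded_linear[OF V] by (simp add: bounded_linear.linear linear_0)
next
  case False
  have ray: "((\<lambda>t. t *\<^sub>R v) \<longlongrightarrow> 0) (at_right (0::real))"
    by (auto intro!: tendsto_eq_intros)
  have "filterlim (\<lambda>t. t *\<^sub>R v) (at 0) (at_right (0::real))"
    unfolding filterlim_at using ray False
    by (auto simp: eventually_at_filter intro!: always_eventually)
  then have sub: "\<forall>\<^sub>F t in at_right 0. - e < 1 / norm (t *\<^sub>R v) * (V (x + t *\<^sub>R v) - V x - \<zeta> \<bullet> (t *\<^sub>R v))"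
    if "e > 0" for e :: real
  proof -
    have "ereal (- e) < 0" using that by simp
    then have "\<forall>\<^sub>F h in at 0. ereal (- e) < ereal (1 / norm h * (V (x + h) - V x - \<zeta> \<bullet> h))"
      using \<zeta> unfolding viscosity_subdifferential_def mem_Collect_eq le_Liminf_iff by blast
    then show ?thesis
      using \<open>filterlim (\<lambda>t. t *\<^sub>R v) (at 0) (at_right (0::real))\<close>
      unfolding less_ereal.simps(1) by (rule eventually_compose_filterlim)
  qed
  note lim = has_derivative_ray[OF V, of v]
  have "\<zeta> \<bullet> v - e * norm v \<le> D v" if "e > 0" for e
  proof (rule tendsto_lowerbound[OF lim])
    show "\<forall>\<^sub>F t in at_right 0. \<zeta> \<bullet> v - e * norm v \<le> (V (x + t *\<^sub>R v) - V x) / t"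
      using sub[OF that] eventually_at_right_less[of "0::real"]
    proof eventually_elim
      case (elim t)
      have "0 < t * norm v" using elim False by simp
      then have "- (e * (t * norm v)) < V (x + t *\<^sub>R v) - V x - t * (\<zeta> \<bullet> v)"
        using elim by (simp add: field_simps)
      then show ?case using elim(2) by (simp add: field_simps)
    qed
  qed simp
  note le = this
  show ?thesis
  proof (rule field_le_epsilon)
    fix e :: real assume "e > 0"
    then show "\<zeta> \<bullet> v \<le> D v + e"
      using le[of "e / norm v"] False by (simp add: algebra_simps)
  qed
qed

section \<open>Mollification of semiconcave functions\<close>

text \<open>The derivative at \<open>x\<close> is taken in the whole space even if \<open>S\<close>
  is not open. It is therefore determined by \<open>f\<close>, and derivatives coming from different
  sets agree on the overlap.\<close>

definition C1_on :: "('a::euclidean_space \<Rightarrow> real) \<Rightarrow> ('a \<Rightarrow> 'a \<Rightarrow>\<^sub>L real) \<Rightarrow> 'a set \<Rightarrow> bool" where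
  "C1_on f f' S \<longleftrightarrow>
     (\<forall>x\<in>S. (f has_derivative blinfun_apply (f' x)) (at x)) \<and> continuous_on S f'"

lemma C1_onD: "C1_on f f' S \<Longrightarrow> x \<in> S \<Longrightarrow> (f has_derivative blinfun_apply (f' x)) (at x)"
  by (simp add: C1_on_def)

lemma C1_on_unique:
  assumes "C1_on f f' S" "C1_on f f'' T" "x \<in> S" "x \<in> T"
  shows "f' x = f'' x"
proof (rule blinfun_eqI)
  show "f' x h = f'' x h" for h
    using has_derivative_unique[OF C1_onD[OF assms(1,3)] C1_onD[OF assms(2,4)]] by simp
qed

text \<open>Each point takes the derivative offered by its own neighbourhood. By uniqueness this
  choice coincides with the single map \<open>D x\<close> on all of \<open>U x \<inter> S\<close>,
  so continuity is inherited locally.\<close>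

lemma C1_on_glue:
  fixes f :: "'a::euclidean_space \<Rightarrow> real"
  assumes "\<And>x. x \<in> S \<Longrightarrow> \<exists>U D. open U \<and> x \<in> U \<and> C1_on f D U"
  obtains f' where "C1_on f f' S"
proof -
  obtain U D where UD: "\<And>x. x \<in> S \<Longrightarrow> open (U x) \<and> x \<in> U x \<and> C1_on f (D x) (U x)"
    using assms by metis
  define f' where "f' = (\<lambda>x. D x x)"
  have der: "(f has_derivative blinfun_apply (f' x)) (at x)" if "x \<in> S" for x
    using UD[OF that] by (auto simp: f'_def C1_on_def)
  have loc: "continuous_on (U x \<inter> S) f'" if "x \<in> S" for x
  proof -
    have "continuous_on (U x \<inter> S) (D x)"
      using UD[OF that] continuous_on_subset[of "U x" "D x" "U x \<inter> S"] by (simp add: C1_on_def)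
    moreover have "f' y = D x y" if "y \<in> U x \<inter> S" for y
      using C1_on_unique[of f "D y" "U y" "D x" "U x" y] UD[of y] UD[OF \<open>x \<in> S\<close>] that
      by (simp add: f'_def)
    ultimately show ?thesis using continuous_on_cong[OF refl, of "U x \<inter> S" f' "D x"] by blast
  qed
  have "continuous (at x within S) f'" if x: "x \<in> S" for x
  proof -
    have "continuous (at x within U x \<inter> S) f'"
      using loc[OF x] UD[OF x] x by (simp add: continuous_on_eq_continuous_within)
    moreover have "at x within U x \<inter> S = at x within S"
      using UD[OF x] by (intro at_within_nhd[of x "U x"]) auto
    ultimately show ?thesis by simp
  qed
  then have "continuous_on S f'"
    by (simp add: continuous_on_eq_continuous_within)
  then have "C1_on f f' S" using der by (simp add: C1_on_def)
  then show thesis by (rule that)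
qed

text \<open>The truncated square is a simple continuously differentiable function vanishing on a
  half-line; the kernel and the cut-off are both built from it. At the kink the quotient is at most
  \<open>\<bar>h\<bar>\<close>.\<close>

lemma max_zero_power2_has_derivative:
  "((\<lambda>s::real. (max 0 s)\<^sup>2) has_real_derivative 2 * max 0 s) (at s)"
proof -
  consider "s < 0" | "s = 0" | "s > 0" by linarith
  then show ?thesis
  proof cases
    case 1
    have "((\<lambda>s::real. 0) has_real_derivative 0) (at s)" by simp
    then have "((\<lambda>s::real. (max 0 s)\<^sup>2) has_real_derivative 0) (at s)"
      by (rule has_field_derivative_transform_within_open[where S="{..<0}"]) (use 1 in auto)
    then show ?thesis using 1 by simp
  next
    case 2
    have "((\<lambda>h::real. ((max 0 h)\<^sup>2 - (max 0 0)\<^sup>2) / h) \<longlongrightarrow> 0) (at 0)"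
    proof (rule Lim_null_comparison)
      show "\<forall>\<^sub>F h::real in at 0. norm (((max 0 h)\<^sup>2 - (max 0 0)\<^sup>2) / h) \<le> \<bar>h\<bar>"
        by (intro always_eventually allI) (auto simp: max_def power2_eq_square)
      show "((\<lambda>h::real. \<bar>h\<bar>) \<longlongrightarrow> 0) (at 0)" by (auto intro!: tendsto_eq_intros)
    qed
    then show ?thesis using 2 by (simp add: DERIV_def)
  next
    case 3
    have "((\<lambda>s::real. s\<^sup>2) has_real_derivative 2 * s) (at s)"
      by (auto intro!: derivative_eq_intros)
    then have "((\<lambda>s::real. (max 0 s)\<^sup>2) has_real_derivative 2 * s) (at s)"
      by (rule has_field_derivative_transform_within_open[where S="{0<..}"]) (use 3 in auto)
    then show ?thesis using 3 by simp
  qed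
qed

text \<open>A box serves as domain because the integral and Leibniz rules are stated for boxes. It
  contains the Euclidean ball of radius \<open>r\<close>, so it captures all the mass of a kernel
  supported there.\<close>

definition cube :: "real \<Rightarrow> 'a::euclidean_space set" where
  "cube r = cbox (- (r *\<^sub>R One)) (r *\<^sub>R One)"

lemma cball_subset_cube: "cball 0 r \<subseteq> (cube r :: 'a::euclidean_space set)"
proof
  fix x :: 'a assume "x \<in> cball 0 r"
  then have "\<bar>x \<bullet> i\<bar> \<le> r" if "i \<in> Basis" for i
    using Basis_le_norm[OF that, of x] by simp
  then show "x \<in> cube r" by (auto simp: cube_def mem_box abs_le_iff minus_le_iff)
qed

text \<open>The truncated square of \<open>r\<^sup>2 - z \<bullet> z\<close> is normalised to mass
  1. One continuous derivative is enough, since only a C1 approximation is sought.\<close>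

lemma C1_kernel:
  assumes "r > 0"
  obtains \<rho> :: "'a::euclidean_space \<Rightarrow> real" and \<rho>' where
    "C1_on \<rho> \<rho>' UNIV" "continuous_on UNIV \<rho>" "\<And>z. 0 \<le> \<rho> z" "\<And>z. r < norm z \<Longrightarrow> \<rho> z = 0"
    "(\<rho> has_integral 1) (cube r)"
proof -
  define p :: "'a \<Rightarrow> real" where "p = (\<lambda>z. (max 0 (r\<^sup>2 - z \<bullet> z))\<^sup>2)"
  define p' :: "'a \<Rightarrow> 'a \<Rightarrow>\<^sub>L real" where
    "p' = (\<lambda>z. (- 4 * max 0 (r\<^sup>2 - z \<bullet> z)) *\<^sub>R blinfun_inner_right z)"
  have der: "(p has_derivative blinfun_apply (p' z)) (at z)" for z
  proof -
    have "((\<lambda>z. r\<^sup>2 - z \<bullet> z) has_derivative (\<lambda>h. - 2 * (z \<bullet> h))) (at z)"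
      by (auto intro!: derivative_eq_intros simp: inner_commute)
    from has_derivative_compose[OF this max_zero_power2_has_derivative[unfolded has_field_derivative_def]]
    show ?thesis by (simp add: p_def p'_def scaleR_blinfun.rep_eq uminus_blinfun.rep_eq o_def algebra_simps)
  qed
  have cont: "continuous_on A p" for A
    unfolding p_def by (intro continuous_intros)
  have "continuous_on UNIV p'"
    unfolding p'_def by (intro continuous_intros)
  then have C1: "C1_on p p' UNIV" using der by (simp add: C1_on_def)
  have zero: "p z = 0" if "r < norm z" for z
  proof -
    have "r\<^sup>2 \<le> z \<bullet> z" using that assms by (simp add: dot_square_norm)
    then show ?thesis by (simp add: p_def)
  qed
  define I where "I = integral (cube r) p"
  have int: "(p has_integral I) (cube r)"
    unfolding I_def cube_def using cont by (intro integrable_integral integrable_continuous)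
  have "I \<ge> 0"
    using int by (rule has_integral_nonneg) (simp add: p_def)
  \<comment> \<open>A continuous nonnegative function with integral zero would vanish on the whole
    box, but \<open>p\<close> is positive at the centre.\<close>
  moreover have "I \<noteq> 0"
  proof
    assume "I = 0"
    have box: "box (- (r *\<^sub>R One)) (r *\<^sub>R One :: 'a) \<noteq> {}"
      using assms by (simp add: box_ne_empty)
    have "(0::'a) \<in> cube r" using cball_subset_cube[of r] assms by auto
    then have "p 0 = 0"
      using has_integral_0_cbox_imp_0[OF cont _ int[unfolded cube_def \<open>I = 0\<close>] box, of 0]
      by (auto simp: p_def cube_def)
    then show False using assms by (simp add: p_def)
  qed
  ultimately have "I > 0" by simp
  have "((\<lambda>z. p z / I) has_integral 1) (cube r)"
    using has_integral_divide[OF int, of I] \<open>I > 0\<close> by simp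
  moreover have "C1_on (\<lambda>z. p z / I) (\<lambda>z. (1 / I) *\<^sub>R p' z) UNIV"
    unfolding C1_on_def
  proof (intro conjI ballI)
    show "((\<lambda>z. p z / I) has_derivative blinfun_apply ((1 / I) *\<^sub>R p' z)) (at z)" for z
      using has_derivative_divide'[OF der has_derivative_const, of I z] \<open>I > 0\<close>
      by (simp add: scaleR_blinfun.rep_eq power2_eq_square)
    show "continuous_on UNIV (\<lambda>z. (1 / I) *\<^sub>R p' z)"
      using \<open>continuous_on UNIV p'\<close> by (intro continuous_intros)
  qed
  moreover have "continuous_on UNIV (\<lambda>z. p z / I)"
    using cont \<open>I > 0\<close> by (intro continuous_on_divide continuous_on_const) auto
  ultimately show thesis
    using \<open>I > 0\<close> zero by (intro that) (auto simp: p_def)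
qed

text \<open>\<open>W x\<close> is a weighted mean of the values \<open>E (x + z)\<close> with
  \<open>norm z \<le> r\<close>, so bounds on these values pass to \<open>W x\<close>. One-sided
  difference quotients are averaged in the same way; the semiconcavity error
  \<open>k * t * (norm v)\<^sup>2\<close> is uniform in \<open>z\<close> and disappears in the
  limit. Thus \<open>\<zeta>\<close> enters only through a bound \<open>c\<close>, never through an
  integral.\<close>

lemma mollification:
  fixes E :: "'a::euclidean_space \<Rightarrow> real"
  assumes cont: "continuous_on UNIV E" and r: "r > 0"
    and semi: "\<And>x y. E y \<le> E x + \<zeta> x \<bullet> (y - x) + k * (norm (y - x))\<^sup>2"
  obtains W W' where "C1_on W W' UNIV"
    "\<And>x c. (\<And>z. norm z \<le> r \<Longrightarrow> E (x + z) \<le> c) \<Longrightarrow> W x \<le> c"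
    "\<And>x c. (\<And>z. norm z \<le> r \<Longrightarrow> c \<le> E (x + z)) \<Longrightarrow> c \<le> W x"
    "\<And>x v c. (\<And>z. norm z \<le> r \<Longrightarrow> \<zeta> (x + z) \<bullet> v \<le> c) \<Longrightarrow> W' x v \<le> c"
proof -
  obtain \<rho> :: "'a \<Rightarrow> real" and \<rho>' where \<rho>: "C1_on \<rho> \<rho>' UNIV" "continuous_on UNIV \<rho>"
    "\<And>z. 0 \<le> \<rho> z" "\<And>z. r < norm z \<Longrightarrow> \<rho> z = 0" "(\<rho> has_integral 1) (cube r)"
    using C1_kernel[OF r] by blast
  define W where "W = (\<lambda>x. integral (cube r) (\<lambda>z. \<rho> z * E (x + z)))"
  have int: "((\<lambda>z. \<rho> z * E (x + z)) has_integral W x) (cube r)" for x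
    unfolding W_def cube_def
  proof (intro integrable_integral integrable_continuous continuous_on_mult)
    show "continuous_on (cbox (- (r *\<^sub>R One)) (r *\<^sub>R One)) (\<lambda>z. E (x + z))"
      by (rule continuous_on_compose2[OF cont]) (auto intro!: continuous_intros)
  qed (rule continuous_on_subset[OF \<rho>(2) subset_UNIV])
  \<comment> \<open>Comparing translates costs exactly \<open>c\<close>, because the kernel has mass
    1; this is applied to difference quotients below.\<close>
  have upper: "W x \<le> W y + c" if "\<And>z. norm z \<le> r \<Longrightarrow> E (x + z) \<le> E (y + z) + c" for x y c
  proof (rule has_integral_le[OF int])
    show "((\<lambda>z. \<rho> z * E (y + z) + c * \<rho> z) has_integral W y + c) (cube r)"
      using has_integral_add[OF int has_integral_mult_right[OF \<rho>(5), of c]] by simp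
    fix z
    show "\<rho> z * E (x + z) \<le> \<rho> z * E (y + z) + c * \<rho> z"
    proof (cases "norm z \<le> r")
      case True
      from mult_left_mono[OF that[OF True] \<rho>(3)[of z]] show ?thesis by (simp add: algebra_simps)
    qed (use \<rho>(4) in simp)
  qed
  have const: "((\<lambda>z. c * \<rho> z) has_integral c) (cube r)" for c
    using has_integral_mult_right[OF \<rho>(5), of c] by simp
  have le: "W x \<le> c" if "\<And>z. norm z \<le> r \<Longrightarrow> E (x + z) \<le> c" for x c
  proof (rule has_integral_le[OF int const])
    show "\<rho> z * E (x + z) \<le> c * \<rho> z" for z
      using mult_left_mono[OF that \<rho>(3)[of z], of z] \<rho>(4)[of z]
      by (cases "norm z \<le> r") (auto simp: mult.commute)
  qed
  have ge: "c \<le> W x" if "\<And>z. norm z \<le> r \<Longrightarrow> c \<le> E (x + z)" for x c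
  proof (rule has_integral_le[OF const int])
    show "c * \<rho> z \<le> \<rho> z * E (x + z)" for z
      using mult_left_mono[OF that \<rho>(3)[of z], of z] \<rho>(4)[of z]
      by (cases "norm z \<le> r") (auto simp: mult.commute)
  qed
  \<comment> \<open>Differentiability is shown locally: for \<open>x\<close> in a unit ball all
    translated supports fit into one fixed cube.\<close>
  have "\<exists>U D. open U \<and> x0 \<in> U \<and> C1_on W D U" for x0
  proof -
    define R where "R = norm x0 + 1"
    have R: "norm x \<le> R" if "x \<in> ball x0 1" for x
      using that norm_triangle_sub[of x x0] by (simp add: R_def dist_norm norm_minus_commute)
    obtain q where q: "\<And>z::'a. z \<in> cube r \<Longrightarrow> norm z \<le> q"
      using bounded_cbox unfolding cube_def bounded_iff by metis
    define Q where "Q = R + q"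
    define D where "D = (\<lambda>x y. (- E y) *\<^sub>R \<rho>' (y - x))"
    \<comment> \<open>The substitution \<open>y = x + z\<close> moves the dependence on
      \<open>x\<close> from \<open>E\<close>, which is merely continuous, to the kernel, which can
      be differentiated under the integral.\<close>
    have W_eq: "W x = integral (cube Q) (\<lambda>y. \<rho> (y - x) * E y)" if "x \<in> ball x0 1" for x
    proof -
      define f where "f = (\<lambda>y. \<rho> (y - x) * E y)"
      have "((\<lambda>z. f (x + z)) has_integral W x) (cube r)"
        using int by (simp add: f_def)
      then have "(f has_integral W x) (cbox (- (r *\<^sub>R One) + x) (r *\<^sub>R One + x))"
        unfolding cube_def using has_integral_shift_cbox_iff[of f x "W x"] by (simp add: o_def)
      moreover have "f y = 0" if "y \<notin> cbox (- (r *\<^sub>R One) + x) (r *\<^sub>R One + x)" for y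
      proof -
        have "y - x \<notin> cube r"
          using that unfolding cube_def by (auto simp: mem_box algebra_simps)
        then have "r < norm (y - x)" using cball_subset_cube[of r] by force
        then show ?thesis by (simp add: f_def \<rho>(4))
      qed
      moreover have "cbox (- (r *\<^sub>R One) + x) (r *\<^sub>R One + x) \<subseteq> cube Q"
      proof
        fix y assume "y \<in> cbox (- (r *\<^sub>R One) + x) (r *\<^sub>R One + x)"
        then have "y - x \<in> cube r"
          unfolding cube_def by (auto simp: mem_box algebra_simps)
        then have "norm (y - x) \<le> q" "norm x \<le> R" using q R[OF \<open>x \<in> ball x0 1\<close>] by auto
        then have "norm y \<le> Q" unfolding Q_def using norm_triangle_sub[of y x] by linarith
        then show "y \<in> cube Q" using cball_subset_cube[of Q] by auto
      qed
      ultimately have "(f has_integral W x) (cube Q)" by (rule has_integral_on_superset)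
      then show ?thesis by (simp add: f_def integral_unique)
    qed
    have contD: "continuous_on (ball x0 1 \<times> cube Q) (\<lambda>(x, y). D x y)"
    proof -
      have "continuous_on (ball x0 1 \<times> cube Q) (\<lambda>p. E (snd p))"
        by (rule continuous_on_compose2[OF cont continuous_on_snd]) (auto intro: continuous_on_id)
      moreover have "continuous_on UNIV \<rho>'" using \<rho>(1) by (simp add: C1_on_def)
      then have "continuous_on (ball x0 1 \<times> cube Q) (\<lambda>p. \<rho>' (snd p - fst p))"
        by (rule continuous_on_compose2) (auto intro!: continuous_intros)
      ultimately show ?thesis
        unfolding D_def split_beta by (intro continuous_on_scaleR continuous_on_minus)
    qed
    have leibniz: "((\<lambda>x. integral (cube Q) (\<lambda>y. \<rho> (y - x) * E y)) has_derivative
        blinfun_apply (integral (cube Q) (D x))) (at x within ball x0 1)" if "x \<in> ball x0 1" for x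
      unfolding cube_def
    proof (rule leibniz_rule)
      show "((\<lambda>x. \<rho> (y - x) * E y) has_derivative blinfun_apply (D x y)) (at x within ball x0 1)"
        for x y
      proof -
        have "((\<lambda>x. y - x) has_derivative (\<lambda>h. - h)) (at x within ball x0 1)"
          by (auto intro!: derivative_eq_intros)
        from has_derivative_compose[OF this C1_onD[OF \<rho>(1) UNIV_I]]
        have "((\<lambda>x. \<rho> (y - x)) has_derivative (\<lambda>h. \<rho>' (y - x) (- h))) (at x within ball x0 1)" .
        from has_derivative_mult_left[OF this, of "E y"] show ?thesis
          by (simp add: D_def scaleR_blinfun.rep_eq blinfun.minus_right uminus_blinfun.rep_eq mult.commute)
      qed
      show "(\<lambda>y. \<rho> (y - x) * E y) integrable_on cbox (- (Q *\<^sub>R One)) (Q *\<^sub>R One)" for x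
      proof (intro integrable_continuous continuous_on_mult)
        show "continuous_on (cbox (- (Q *\<^sub>R One)) (Q *\<^sub>R One)) (\<lambda>y. \<rho> (y - x))"
          by (rule continuous_on_compose2[OF \<rho>(2)]) (auto intro!: continuous_intros)
      qed (rule continuous_on_subset[OF cont subset_UNIV])
    qed (use contD that in \<open>auto simp: cube_def\<close>)
    have "(W has_derivative blinfun_apply (integral (cube Q) (D x))) (at x)"
      if "x \<in> ball x0 1" for x
      using has_derivative_transform[OF that W_eq leibniz[OF that]] at_within_open[OF that open_ball]
      by simp
    moreover have "continuous_on (ball x0 1) (\<lambda>x. integral (cube Q) (D x))"
      using contD unfolding cube_def by (rule integral_continuous_on_param)
    ultimately have "C1_on W (\<lambda>x. integral (cube Q) (D x)) (ball x0 1)"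
      by (simp add: C1_on_def)
    then show ?thesis by (intro exI[of _ "ball x0 1"]) auto
  qed
  then obtain W' where W': "C1_on W W' UNIV" using C1_on_glue[of UNIV W] by auto
  have "W' x v \<le> c" if c: "\<And>z. norm z \<le> r \<Longrightarrow> \<zeta> (x + z) \<bullet> v \<le> c" for x v c
  proof -
    have "((\<lambda>t. c + k * t * (norm v)\<^sup>2) \<longlongrightarrow> c + k * 0 * (norm v)\<^sup>2) (at_right 0)"
      by (intro tendsto_intros)
    then have lim: "((\<lambda>t. c + k * t * (norm v)\<^sup>2) \<longlongrightarrow> c) (at_right 0)" by simp
    show ?thesis
    proof (rule tendsto_le[OF _ lim has_derivative_ray[OF C1_onD[OF W' UNIV_I]]])
      show "\<forall>\<^sub>F t in at_right 0. (W (x + t *\<^sub>R v) - W x) / t \<le> c + k * t * (norm v)\<^sup>2"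
        using eventually_at_right_less[of "0::real"]
      proof eventually_elim
        case (elim t)
        \<comment> \<open>The supergradient inequality at each \<open>x + z\<close> is averaged;
          dividing by \<open>t\<close> leaves \<open>c\<close> plus a term of order
          \<open>t\<close>.\<close>
        have "W (x + t *\<^sub>R v) \<le> W x + (t * c + k * (t * norm v)\<^sup>2)"
        proof (rule upper)
          fix z :: 'a assume z: "norm z \<le> r"
          have "E (x + t *\<^sub>R v + z) \<le> E (x + z) + t * (\<zeta> (x + z) \<bullet> v) + k * (t * norm v)\<^sup>2"
            using semi[of "x + t *\<^sub>R v + z" "x + z"] elim by (simp add: algebra_simps)
          also have "t * (\<zeta> (x + z) \<bullet> v) \<le> t * c" using c[OF z] elim by simp
          finally show "E (x + t *\<^sub>R v + z) \<le> E (x + z) + (t * c + k * (t * norm v)\<^sup>2)" by simp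
        qed
        then show ?case using elim by (simp add: field_simps power2_eq_square)
      qed
    qed simp
  qed
  then show thesis using that W' le ge by blast
qed

section \<open>Smooth approximation on a shell\<close>

text \<open>Outside the ball of radius \<open>sqrt (V x / k)\<close> around \<open>x\<close> the
  penalty alone is at least \<open>V x\<close>, the value at the competitor \<open>y = x\<close>.
  Hence a minimiser on this compact ball is global.\<close>

lemma proximal_point:
  fixes V :: "'a::euclidean_space \<Rightarrow> real"
  assumes "continuous_on UNIV V" "\<And>x. 0 \<le> V x" "k > 0"
  obtains p where "\<And>x y. V (p x) + k * (norm (x - p x))\<^sup>2 \<le> V y + k * (norm (x - y))\<^sup>2"
proof -
  have "\<exists>p. \<forall>y. V p + k * (norm (x - p))\<^sup>2 \<le> V y + k * (norm (x - y))\<^sup>2" for x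
  proof -
    define \<phi> where "\<phi> = (\<lambda>y. V y + k * (norm (x - y))\<^sup>2)"
    define s where "s = sqrt (V x / k)"
    have "s \<ge> 0" using assms by (simp add: s_def)
    have "continuous_on (cball x s) \<phi>"
      unfolding \<phi>_def by (intro continuous_intros continuous_on_subset[OF assms(1)]) auto
    then obtain p where p: "p \<in> cball x s" "\<And>y. y \<in> cball x s \<Longrightarrow> \<phi> p \<le> \<phi> y"
      using continuous_attains_inf[of "cball x s" \<phi>] \<open>s \<ge> 0\<close> by auto
    have "\<phi> p \<le> \<phi> y" for y
    proof (cases "y \<in> cball x s")
      case False
      then have "s < norm (x - y)" by (simp add: dist_norm)
      then have "s\<^sup>2 \<le> (norm (x - y))\<^sup>2" using \<open>s \<ge> 0\<close> by (intro power_mono) auto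
      then have "V x \<le> k * (norm (x - y))\<^sup>2" using assms by (simp add: s_def field_simps)
      then have "\<phi> x \<le> \<phi> y" using assms(2)[of y] by (simp add: \<phi>_def)
      moreover have "\<phi> p \<le> \<phi> x" using p(2) \<open>s \<ge> 0\<close> by simp
      ultimately show ?thesis by simp
    qed (use p in auto)
    then show ?thesis by (auto simp: \<phi>_def)
  qed
  then show thesis using that by metis
qed

text \<open>The one-sided bound is used twice, based at \<open>x0\<close> and at the nearby point
  \<open>x\<close>. The second use is why \<open>\<zeta>\<close> must be bounded on a whole
  neighbourhood and not just at \<open>x0\<close>.\<close>

lemma continuous_on_if_local_upper_bound:
  fixes E :: "'a::euclidean_space \<Rightarrow> real"
  assumes semi: "\<And>x y. E y \<le> E x + \<zeta> x \<bullet> (y - x) + k * (norm (y - x))\<^sup>2"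
    and bound: "\<And>x0. \<exists>D. \<forall>x\<in>cball x0 1. norm (\<zeta> x) \<le> D"
  shows "continuous_on UNIV E"
  unfolding continuous_on_eq_continuous_at[OF open_UNIV] isCont_def
proof
  fix x0
  obtain D where D: "\<And>x. x \<in> cball x0 1 \<Longrightarrow> norm (\<zeta> x) \<le> D" using bound by blast
  have "((\<lambda>x. D * norm (x - x0) + k * (norm (x - x0))\<^sup>2) \<longlongrightarrow>
      D * norm (x0 - x0) + k * (norm (x0 - x0))\<^sup>2) (at x0)"
    by (intro tendsto_intros)
  then have lim: "((\<lambda>x. D * norm (x - x0) + k * (norm (x - x0))\<^sup>2) \<longlongrightarrow> 0) (at x0)" by simp
  have "((\<lambda>x. E x - E x0) \<longlongrightarrow> 0) (at x0)"
  proof (rule Lim_null_comparison[OF _ lim])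
    have "\<forall>\<^sub>F x in at x0. x \<in> ball x0 1"
      by (intro eventually_at_in_open') auto
    then show "\<forall>\<^sub>F x in at x0. norm (E x - E x0) \<le> D * norm (x - x0) + k * (norm (x - x0))\<^sup>2"
    proof eventually_elim
      case (elim x)
      have le: "E y \<le> E z + D * norm (y - z) + k * (norm (y - z))\<^sup>2"
        if "z \<in> cball x0 1" for y z
      proof -
        have "\<zeta> z \<bullet> (y - z) \<le> norm (\<zeta> z) * norm (y - z)" by (rule norm_cauchy_schwarz)
        also have "\<dots> \<le> D * norm (y - z)" using D[OF that] by (intro mult_right_mono) auto
        finally show ?thesis using semi[of y z] by simp
      qed
      have "x \<in> cball x0 1" "x0 \<in> cball x0 1" using elim by auto
      then show ?case using le[of x x0] le[of x0 x] by (simp add: norm_minus_commute abs_le_iff)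
    qed
  qed
  then show "E \<midarrow>x0\<rightarrow> E x0" by (simp add: LIM_zero_cancel)
qed

section \<open>Perturbation of the dissipation inequality\<close>

lemma storage_functionsD:
  assumes "V \<in> storage_functions F \<gamma>"
  shows "continuous_on UNIV V" "0 \<le> V x"
    "\<zeta> \<in> viscosity_subdifferential V x \<Longrightarrow> x \<noteq> 0 \<Longrightarrow>
      \<zeta> \<bullet> F x u \<le> - (norm x)\<^sup>2 + \<gamma> * (norm u)\<^sup>2"
  using assms by (auto simp: storage_functions_def)

text \<open>The Lipschitz constant in the state may grow linearly with the input, as it does for a
  system affine in \<open>u\<close>.\<close>

definition Lipschitz_on_bounded :: "('a::euclidean_space \<Rightarrow> 'u::euclidean_space \<Rightarrow> 'a) \<Rightarrow> bool" where
  "Lipschitz_on_bounded F \<longleftrightarrow> (\<forall>R. \<exists>L\<ge>0. \<forall>x y u. norm x \<le> R \<longrightarrow> norm y \<le> R \<longrightarrow>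
     norm (F x u - F y u) \<le> L * (1 + norm u) * norm (x - y))"

lemma continuous_uniformly_on_cball:
  fixes V :: "'a::euclidean_space \<Rightarrow> real"
  assumes V: "continuous_on UNIV V" and e: "0 < e"
  obtains \<delta> where "\<delta> > 0"
    "\<And>x y. norm x \<le> R \<Longrightarrow> norm y \<le> R \<Longrightarrow> norm (x - y) < \<delta> \<Longrightarrow> \<bar>V x - V y\<bar> < e"
proof -
  have "uniformly_continuous_on (cball 0 R) V"
    using continuous_on_subset[OF V] by (intro compact_uniformly_continuous) auto
  then obtain \<delta> where "\<delta> > 0"
    and \<delta>: "\<And>x y. x \<in> cball 0 R \<Longrightarrow> y \<in> cball 0 R \<Longrightarrow> dist y x < \<delta> \<Longrightarrow> dist (V y) (V x) < e"
    using e unfolding uniformly_continuous_on_def by blast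
  show thesis
  proof (rule that[OF \<open>\<delta> > 0\<close>])
    show "\<bar>V x - V y\<bar> < e" if "norm x \<le> R" "norm y \<le> R" "norm (x - y) < \<delta>" for x y
      using \<delta>[of y x] that by (simp add: dist_norm)
  qed
qed

text \<open>Turns linear growth in the input into the quadratic form in which all errors are
  measured.\<close>

lemma one_plus_norm_le:
  fixes u :: "'u::real_normed_vector"
  shows "1 + norm u \<le> 2 * (1 + (norm u)\<^sup>2)"
proof -
  have "2 * (1 + (norm u)\<^sup>2) - (1 + norm u) = (norm u - 1)\<^sup>2 + (norm u)\<^sup>2 + norm u"
    by (simp add: power2_eq_square algebra_simps)
  also have "0 \<le> \<dots>" by simp
  finally show ?thesis by simp
qed

lemma norm_power2_perturb:
  fixes x y :: "'a::real_normed_vector"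
  assumes "norm x \<le> R" "norm y \<le> R"
  shows "- (norm y)\<^sup>2 \<le> - (norm x)\<^sup>2 + 2 * R * norm (x - y)"
proof -
  have "(norm x)\<^sup>2 - (norm y)\<^sup>2 = (norm x + norm y) * (norm x - norm y)"
    by (simp add: power2_eq_square algebra_simps)
  also have "\<dots> \<le> (norm x + norm y) * norm (x - y)"
    by (intro mult_left_mono norm_triangle_ineq2) auto
  also have "\<dots> \<le> 2 * R * norm (x - y)"
    using assms by (intro mult_right_mono) auto
  finally show ?thesis by simp
qed

text \<open>Only the product of \<open>norm \<zeta>\<close> and the displacement has to be small:
  for the Moreau envelope \<open>\<zeta>\<close> itself may grow large as the penalty
  increases.\<close>

lemma inner_vector_field_perturb:
  fixes F :: "'a::euclidean_space \<Rightarrow> 'u::euclidean_space \<Rightarrow> 'a"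
  assumes F: "norm (F x u - F y u) \<le> L * (1 + norm u) * norm (x - y)"
    and small: "norm \<zeta> * norm (x - y) \<le> e" and "L \<ge> 0"
  shows "\<zeta> \<bullet> F x u \<le> \<zeta> \<bullet> F y u + e * L * (1 + norm u)"
proof -
  have "\<zeta> \<bullet> F x u - \<zeta> \<bullet> F y u \<le> norm \<zeta> * norm (F x u - F y u)"
    by (metis inner_diff_right norm_cauchy_schwarz)
  also have "\<dots> \<le> norm \<zeta> * (L * (1 + norm u) * norm (x - y))"
    by (intro mult_left_mono F) auto
  also have "\<dots> = (norm \<zeta> * norm (x - y)) * (L * (1 + norm u))"
    by (simp add: mult_ac)
  also have "\<dots> \<le> e * (L * (1 + norm u))"
    using assms by (intro mult_right_mono small) auto
  finally show ?thesis by (simp add: mult_ac)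
qed

text \<open>
  The approximation is the Moreau envelope \<open>E x = min\<^sub>y V y + k |x - y|\<^sup>2\<close>. With a minimiser \<open>p x\<close>,
  the vector \<open>\<zeta> x = 2 k (x - p x)\<close> is a subgradient of \<open>V\<close> at \<open>p x\<close>, where the dissipation inequality
  applies, and at the same time a supergradient of \<open>E\<close> at \<open>x\<close>. Moving the inequality from \<open>p x\<close> to
  \<open>x\<close> costs \<open>|\<zeta> x| |x - p x| = 2 k |x - p x|\<^sup>2\<close>, which is small because \<open>V\<close> is continuous.
\<close>

lemma semiconcave_approximation:
  fixes F :: "'a::euclidean_space \<Rightarrow> 'u::euclidean_space \<Rightarrow> 'a"
  assumes V: "V \<in> storage_functions F \<gamma>" and F: "Lipschitz_on_bounded F"
    and a: "0 < a" and \<epsilon>: "0 < \<epsilon>"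
  obtains E \<zeta> k D where "continuous_on UNIV E"
    "\<And>x y. E y \<le> E x + \<zeta> x \<bullet> (y - x) + k * (norm (y - x))\<^sup>2"
    "\<And>x. a \<le> norm x \<Longrightarrow> norm x \<le> b \<Longrightarrow> \<bar>E x - V x\<bar> \<le> \<epsilon>"
    "\<And>x. a \<le> norm x \<Longrightarrow> norm x \<le> b \<Longrightarrow> norm (\<zeta> x) \<le> D"
    "\<And>x u. a \<le> norm x \<Longrightarrow> norm x \<le> b \<Longrightarrow>
       \<zeta> x \<bullet> F x u \<le> - (norm x)\<^sup>2 + \<gamma> * (norm u)\<^sup>2 + \<epsilon> * (1 + (norm u)\<^sup>2)"
proof -
  note contV = storage_functionsD(1)[OF V] and V0 = storage_functionsD(2)[OF V]
  \<comment> \<open>Minimisers move by less than \<open>a / 2\<close>, so points of the shell and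
    their minimisers share the radius \<open>R\<close>; the absolute value keeps \<open>R\<close>
    positive for every \<open>b\<close>.\<close>
  define R where "R = \<bar>b\<bar> + a"
  have "R > 0" using a by (simp add: R_def)
  obtain L where L: "L \<ge> 0" "\<And>x y u. norm x \<le> R \<Longrightarrow> norm y \<le> R \<Longrightarrow>
      norm (F x u - F y u) \<le> L * (1 + norm u) * norm (x - y)"
    using F unfolding Lipschitz_on_bounded_def by blast
  have V_bound: "\<exists>M. \<forall>x\<in>cball c s. V x \<le> M" for c s
  proof -
    have "compact (V ` cball c s)"
      using continuous_on_subset[OF contV] by (intro compact_continuous_image) auto
    then have "bdd_above (V ` cball c s)"
      by (intro bounded_imp_bdd_above compact_imp_bounded)
    then show ?thesis unfolding bdd_above_def by blast
  qed
  obtain M where M: "\<And>x. norm x \<le> R \<Longrightarrow> V x \<le> M"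
    using V_bound[of 0 R] by (metis mem_cball_0)
  have "M \<ge> 0" using M[of 0] V0[of 0] \<open>R > 0\<close> by simp
  \<comment> \<open>The final error is \<open>e * (2 * L + 1)\<close> times
    \<open>1 + norm u\<close>: \<open>2 * L\<close> from moving the vector field, 1 from moving the
    squared norm. The remaining factor 2 comes from \<open>one_plus_norm_le\<close>.\<close>
  define e where "e = \<epsilon> / (2 * (2 * L + 1))"
  have e: "0 < e" "e \<le> \<epsilon>" "2 * e * (2 * L + 1) = \<epsilon>"
    using \<epsilon> L(1) by (auto simp: e_def field_simps)
  obtain \<delta>1 where \<delta>1: "\<delta>1 > 0"
    "\<And>x y. norm x \<le> R \<Longrightarrow> norm y \<le> R \<Longrightarrow> norm (x - y) < \<delta>1 \<Longrightarrow> \<bar>V x - V y\<bar> < e"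
    using continuous_uniformly_on_cball[OF contV e(1)] by blast
  \<comment> \<open>A displacement below \<open>\<delta>\<close> changes \<open>V\<close> by less
    than \<open>e\<close>, keeps minimisers away from the origin and changes the squared norm by at
    most \<open>e\<close>.\<close>
  define \<delta> where "\<delta> = min \<delta>1 (min (a / 2) (e / (2 * R)))"
  have "\<delta> \<le> e / (2 * R)" unfolding \<delta>_def by linarith
  then have "2 * R * \<delta> \<le> e" using \<open>R > 0\<close> by (simp add: field_simps)
  then have \<delta>: "\<delta> > 0" "\<delta> \<le> \<delta>1" "\<delta> \<le> a / 2" "2 * R * \<delta> \<le> e"
    using \<delta>1(1) a e(1) \<open>R > 0\<close> by (auto simp: \<delta>_def)
  \<comment> \<open>This penalty satisfies \<open>k * \<delta>\<^sup>2 = M + 1\<close>, which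
    exceeds \<open>M\<close>, so for a point of norm at most \<open>R\<close> no minimiser can be at
    distance \<open>\<delta>\<close> or more.\<close>
  define k where "k = (M + 1) / \<delta>\<^sup>2"
  have "k > 0" using \<open>M \<ge> 0\<close> \<delta> by (simp add: k_def)
  obtain p where p: "\<And>x y. V (p x) + k * (norm (x - p x))\<^sup>2 \<le> V y + k * (norm (x - y))\<^sup>2"
    using proximal_point[OF contV V0 \<open>k > 0\<close>] by blast
  define E where "E = (\<lambda>x. V (p x) + k * (norm (x - p x))\<^sup>2)"
  define \<zeta> where "\<zeta> = (\<lambda>x. (2 * k) *\<^sub>R (x - p x))"
  have square: "k * (norm (y - q))\<^sup>2 = k * (norm (x - q))\<^sup>2 + ((2 * k) *\<^sub>R (x - q)) \<bullet> (y - x)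
      + k * (norm (y - x))\<^sup>2" for x y q :: 'a
    by (simp add: power2_norm_eq_inner algebra_simps inner_commute)
  \<comment> \<open>The minimiser \<open>p x\<close> serves as competitor at \<open>y\<close>, and
    the quadratic penalty is expanded exactly around \<open>x\<close>.\<close>
  have semi: "E y \<le> E x + \<zeta> x \<bullet> (y - x) + k * (norm (y - x))\<^sup>2" for x y
    using p[of y "p x"] square[of y "p x" x] by (simp add: E_def \<zeta>_def)
  have subgradient: "\<zeta> x \<in> viscosity_subdifferential V (p x)" for x
  proof (rule viscosity_subdifferentialI)
    fix y
    have "k * (norm (x - y))\<^sup>2 = k * (norm (x - p x))\<^sup>2 - \<zeta> x \<bullet> (y - p x) + k * (norm (y - p x))\<^sup>2"
      unfolding \<zeta>_def by (simp add: power2_norm_eq_inner algebra_simps inner_commute)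
    then show "V (p x) + \<zeta> x \<bullet> (y - p x) - k * (norm (y - p x))\<^sup>2 \<le> V y"
      using p[of x y] by simp
  qed
  have p_self: "V (p x) + k * (norm (x - p x))\<^sup>2 \<le> V x" for x
    using p[of x x] by simp
  \<comment> \<open>The penalty at the minimiser is at most \<open>V x\<close>, so
    \<open>\<zeta>\<close> is locally bounded; with semiconcavity this yields continuity of
    \<open>E\<close>.\<close>
  have "\<exists>D. \<forall>x\<in>cball x0 1. norm (\<zeta> x) \<le> D" for x0
  proof -
    obtain B where B: "\<And>x. x \<in> cball x0 1 \<Longrightarrow> V x \<le> B" using V_bound by blast
    have "norm (\<zeta> x) \<le> 2 * k * sqrt (B / k)" if "x \<in> cball x0 1" for x
    proof -
      have "k * (norm (x - p x))\<^sup>2 \<le> B" using p_self[of x] V0[of "p x"] B[OF that] by simp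
      then have "(norm (x - p x))\<^sup>2 \<le> B / k" using \<open>k > 0\<close> by (simp add: field_simps)
      then have "norm (x - p x) \<le> sqrt (B / k)" by (rule real_le_rsqrt)
      then show ?thesis using \<open>k > 0\<close> by (simp add: \<zeta>_def)
    qed
    then show ?thesis by blast
  qed
  with semi have contE: "continuous_on UNIV E" by (rule continuous_on_if_local_upper_bound)
  have near: "norm (x - p x) < \<delta>" if "norm x \<le> R" for x
  proof -
    have "k * (norm (x - p x))\<^sup>2 \<le> M" using p_self[of x] V0[of "p x"] M[OF that] by simp
    also have "M < k * \<delta>\<^sup>2" using \<delta>(1) by (simp add: k_def)
    finally have "(norm (x - p x))\<^sup>2 < \<delta>\<^sup>2" using \<open>k > 0\<close> by simp
    then show ?thesis using \<delta>(1) by (rule power2_less_imp_less[OF _ less_imp_le])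
  qed
  have shell: "norm x \<le> R" "norm (p x) \<le> R" "p x \<noteq> 0" "k * (norm (x - p x))\<^sup>2 \<le> e"
      "\<bar>V x - V (p x)\<bar> < e"
    if x: "a \<le> norm x" "norm x \<le> b" for x :: 'a
  proof -
    show *: "norm x \<le> R" using x a by (simp add: R_def)
    show **: "norm (p x) \<le> R"
      using near[OF *] \<delta>(3) x a norm_triangle_sub[of "p x" x] by (simp add: R_def norm_minus_commute)
    show "p x \<noteq> 0" using near[OF *] \<delta>(3) x a by auto
    show ***: "\<bar>V x - V (p x)\<bar> < e" using \<delta>1(2)[OF * **] near[OF *] \<delta>(2) by simp
    \<comment> \<open>Second stage: the displacement is already known to be below
      \<open>\<delta>\<close>, so the penalty is bounded by the oscillation of \<open>V\<close>.
      This replaces the crude bound \<open>M\<close> by \<open>e\<close>.\<close>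
    show "k * (norm (x - p x))\<^sup>2 \<le> e" using p_self[of x] *** by simp
  qed
  show thesis
  proof (rule that[OF contE semi])
    fix x :: 'a assume x: "a \<le> norm x" "norm x \<le> b"
    note sh = shell[OF x]
    have "0 \<le> k * (norm (x - p x))\<^sup>2" using \<open>k > 0\<close> by simp
    then show "\<bar>E x - V x\<bar> \<le> \<epsilon>"
      using sh(4,5) p_self[of x] e(2) unfolding E_def by linarith
    show "norm (\<zeta> x) \<le> 2 * k * \<delta>"
      using near[OF sh(1)] \<open>k > 0\<close> by (simp add: \<zeta>_def)
    fix u :: 'u
    have "norm (\<zeta> x) * norm (x - p x) \<le> 2 * e"
      using sh(4) \<open>k > 0\<close> by (simp add: \<zeta>_def power2_eq_square mult_ac)
    then have "\<zeta> x \<bullet> F x u \<le> \<zeta> x \<bullet> F (p x) u + 2 * e * L * (1 + norm u)"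
      using L(2)[OF sh(1,2)] L(1) by (intro inner_vector_field_perturb)
    also have "\<zeta> x \<bullet> F (p x) u \<le> - (norm (p x))\<^sup>2 + \<gamma> * (norm u)\<^sup>2"
      using storage_functionsD(3)[OF V subgradient sh(3)] .
    also have "- (norm (p x))\<^sup>2 \<le> - (norm x)\<^sup>2 + e"
    proof -
      have "2 * R * norm (x - p x) \<le> 2 * R * \<delta>"
        using near[OF sh(1)] \<open>R > 0\<close> by simp
      then show ?thesis using norm_power2_perturb[OF sh(1,2)] \<delta>(4) by simp
    qed
    finally have "\<zeta> x \<bullet> F x u \<le> - (norm x)\<^sup>2 + \<gamma> * (norm u)\<^sup>2 + (e + 2 * e * L * (1 + norm u))"
      by simp
    also have "e + 2 * e * L * (1 + norm u) \<le> e * (2 * L + 1) * (1 + norm u)"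
      using e(1) L(1) by (simp add: algebra_simps)
    also have "\<dots> \<le> e * (2 * L + 1) * (2 * (1 + (norm u)\<^sup>2))"
      using e(1) L(1) by (intro mult_left_mono one_plus_norm_le) auto
    also have "\<dots> = (2 * e * (2 * L + 1)) * (1 + (norm u)\<^sup>2)"
      by (simp only: mult_ac)
    also have "\<dots> = \<epsilon> * (1 + (norm u)\<^sup>2)" by (simp only: e(3))
    finally show "\<zeta> x \<bullet> F x u \<le> - (norm x)\<^sup>2 + \<gamma> * (norm u)\<^sup>2 + \<epsilon> * (1 + (norm u)\<^sup>2)"
      by simp
  qed
qed

text \<open>The envelope is built on the larger shell from \<open>a / 2\<close> to
  \<open>\<bar>b\<bar> + a\<close>, so that the averaging balls around points of the given shell
  stay inside it. Its semiconcavity constant and the bound \<open>D\<close> are fixed before the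
  mollification radius is chosen.\<close>

lemma smooth_approximation_on_shell:
  fixes F :: "'a::euclidean_space \<Rightarrow> 'u::euclidean_space \<Rightarrow> 'a"
  assumes V: "V \<in> storage_functions F \<gamma>" and F: "Lipschitz_on_bounded F"
    and a: "0 < a" and \<epsilon>: "0 < \<epsilon>"
  obtains W W' where "C1_on W W' UNIV"
    "\<And>x. a \<le> norm x \<Longrightarrow> norm x \<le> b \<Longrightarrow> \<bar>W x - V x\<bar> \<le> \<epsilon>"
    "\<And>x u. a \<le> norm x \<Longrightarrow> norm x \<le> b \<Longrightarrow>
       W' x (F x u) \<le> - (norm x)\<^sup>2 + \<gamma> * (norm u)\<^sup>2 + \<epsilon> * (1 + (norm u)\<^sup>2)"
proof -
  define R where "R = \<bar>b\<bar> + a"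
  have "R > 0" using a by (simp add: R_def)
  have "\<epsilon> / 4 > 0" using \<epsilon> by simp
  obtain E \<zeta> k D where E: "continuous_on UNIV E"
    "\<And>x y. E y \<le> E x + \<zeta> x \<bullet> (y - x) + k * (norm (y - x))\<^sup>2"
    "\<And>x. a / 2 \<le> norm x \<Longrightarrow> norm x \<le> R \<Longrightarrow> \<bar>E x - V x\<bar> \<le> \<epsilon> / 4"
    "\<And>x. a / 2 \<le> norm x \<Longrightarrow> norm x \<le> R \<Longrightarrow> norm (\<zeta> x) \<le> D"
    "\<And>x u. a / 2 \<le> norm x \<Longrightarrow> norm x \<le> R \<Longrightarrow>
       \<zeta> x \<bullet> F x u \<le> - (norm x)\<^sup>2 + \<gamma> * (norm u)\<^sup>2 + \<epsilon> / 4 * (1 + (norm u)\<^sup>2)"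
    using semiconcave_approximation[OF V F, of "a / 2" "\<epsilon> / 4" R] half_gt_zero[OF a] \<open>\<epsilon> / 4 > 0\<close>
    by blast
  obtain L where L: "L \<ge> 0" "\<And>x y u. norm x \<le> R \<Longrightarrow> norm y \<le> R \<Longrightarrow>
      norm (F x u - F y u) \<le> L * (1 + norm u) * norm (x - y)"
    using F unfolding Lipschitz_on_bounded_def by blast
  obtain \<delta> where \<delta>: "\<delta> > 0"
    "\<And>x y. norm x \<le> R \<Longrightarrow> norm y \<le> R \<Longrightarrow> norm (x - y) < \<delta> \<Longrightarrow> \<bar>V x - V y\<bar> < \<epsilon> / 4"
    using continuous_uniformly_on_cball[OF storage_functionsD(1)[OF V] \<open>\<epsilon> / 4 > 0\<close>] by blast
  \<comment> \<open>The four bounds ensure, in order, small oscillation of \<open>V\<close>,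
    averaging inside the larger shell, small change of the squared norm, and small change of the
    vector field against a supergradient of size at most \<open>D\<close>. The added 1 avoids a zero
    denominator.\<close>
  define r where "r = Min {\<delta> / 2, a / 2, \<epsilon> / 8 / R, \<epsilon> / 8 / (\<bar>D\<bar> * L + 1)}"
  have "\<bar>D\<bar> * L \<ge> 0" using L(1) by simp
  then have r: "0 < r" "r < \<delta>" "r \<le> a / 2" "2 * R * r \<le> \<epsilon> / 4" "2 * (\<bar>D\<bar> * r * L) \<le> \<epsilon> / 4"
  proof -
    have "r \<le> \<delta> / 2" "r \<le> a / 2" "r \<le> \<epsilon> / 8 / R" and last: "r \<le> \<epsilon> / 8 / (\<bar>D\<bar> * L + 1)"
      unfolding r_def by (intro Min_le; simp)+
    show "0 < r" using \<delta> a \<epsilon> \<open>R > 0\<close> \<open>\<bar>D\<bar> * L \<ge> 0\<close> by (simp add: r_def)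
    show "r < \<delta>" "r \<le> a / 2" using \<open>r \<le> \<delta> / 2\<close> \<open>r \<le> a / 2\<close> \<delta> by auto
    show "2 * R * r \<le> \<epsilon> / 4" using \<open>r \<le> \<epsilon> / 8 / R\<close> \<open>R > 0\<close> by (simp add: field_simps)
    have "r * (\<bar>D\<bar> * L + 1) \<le> \<epsilon> / 8"
      using last \<open>\<bar>D\<bar> * L \<ge> 0\<close> by (subst (asm) pos_le_divide_eq) auto
    then show "2 * (\<bar>D\<bar> * r * L) \<le> \<epsilon> / 4" using \<open>0 < r\<close> by (simp add: algebra_simps)
  qed
  obtain W W' where W: "C1_on W W' UNIV"
    "\<And>x c. (\<And>z. norm z \<le> r \<Longrightarrow> E (x + z) \<le> c) \<Longrightarrow> W x \<le> c"
    "\<And>x c. (\<And>z. norm z \<le> r \<Longrightarrow> c \<le> E (x + z)) \<Longrightarrow> c \<le> W x"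
    "\<And>x v c. (\<And>z. norm z \<le> r \<Longrightarrow> \<zeta> (x + z) \<bullet> v \<le> c) \<Longrightarrow> W' x v \<le> c"
    using mollification[OF E(1) r(1) E(2)] by blast
  have shell: "a / 2 \<le> norm (x + z)" "norm (x + z) \<le> R" "norm x \<le> R"
    if "a \<le> norm x" "norm x \<le> b" "norm z \<le> r" for x z :: 'a
    using that r(3) a norm_triangle_ineq[of x z] norm_diff_ineq[of x z] by (auto simp: R_def)
  show thesis
  proof (rule that[OF W(1)])
    fix x :: 'a assume x: "a \<le> norm x" "norm x \<le> b"
    have "V x - \<epsilon> \<le> E (x + z) \<and> E (x + z) \<le> V x + \<epsilon>" if "norm z \<le> r" for z
    proof -
      note sh = shell[OF x that]
      have "\<bar>V (x + z) - V x\<bar> < \<epsilon> / 4"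
        using \<delta>(2)[OF sh(2,3)] that r(2) by simp
      then show ?thesis using E(3)[OF sh(1,2)] \<epsilon> by linarith
    qed
    then have "V x - \<epsilon> \<le> W x" "W x \<le> V x + \<epsilon>" using W(2,3) by blast+
    then show "\<bar>W x - V x\<bar> \<le> \<epsilon>" by linarith
    fix u :: 'u
    show "W' x (F x u) \<le> - (norm x)\<^sup>2 + \<gamma> * (norm u)\<^sup>2 + \<epsilon> * (1 + (norm u)\<^sup>2)"
    \<comment> \<open>\<open>F x u\<close> is a fixed direction during the averaging, whereas
      dissipation at \<open>x + z\<close> involves \<open>F (x + z) u\<close>; the Lipschitz bound
      bridges the two.\<close>
    proof (rule W(4))
      fix z :: 'a assume z: "norm z \<le> r"
      note sh = shell[OF x z]
      have "norm (\<zeta> (x + z)) * norm (x - (x + z)) \<le> \<bar>D\<bar> * r"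
        using E(4)[OF sh(1,2)] z by (intro mult_mono) auto
      then have "\<zeta> (x + z) \<bullet> F x u \<le> \<zeta> (x + z) \<bullet> F (x + z) u + \<bar>D\<bar> * r * L * (1 + norm u)"
        using L(2)[OF sh(3,2)] L(1) by (intro inner_vector_field_perturb)
      also have "\<bar>D\<bar> * r * L * (1 + norm u) \<le> \<bar>D\<bar> * r * L * (2 * (1 + (norm u)\<^sup>2))"
        using r(1) L(1) by (intro mult_left_mono one_plus_norm_le) auto
      also have "\<dots> = 2 * (\<bar>D\<bar> * r * L) * (1 + (norm u)\<^sup>2)" by (simp add: mult_ac)
      also have "\<dots> \<le> \<epsilon> / 4 * (1 + (norm u)\<^sup>2)"
        using r(5) by (intro mult_right_mono) auto
      also have "\<zeta> (x + z) \<bullet> F (x + z) u \<le>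
          - (norm (x + z))\<^sup>2 + \<gamma> * (norm u)\<^sup>2 + \<epsilon> / 4 * (1 + (norm u)\<^sup>2)"
        using E(5)[OF sh(1,2)] .
      also have "- (norm (x + z))\<^sup>2 \<le> - (norm x)\<^sup>2 + \<epsilon> / 4"
      proof -
        have "2 * R * norm (x - (x + z)) \<le> 2 * R * r"
          using z \<open>R > 0\<close> by simp
        then show ?thesis using norm_power2_perturb[OF sh(3,2)] r(4) by simp
      qed
      finally have "\<zeta> (x + z) \<bullet> F x u \<le> - (norm x)\<^sup>2 + \<gamma> * (norm u)\<^sup>2 + \<epsilon> / 4
          + 2 * (\<epsilon> / 4 * (1 + (norm u)\<^sup>2))" by simp
      also have "\<dots> \<le> - (norm x)\<^sup>2 + \<gamma> * (norm u)\<^sup>2 + \<epsilon> * (1 + (norm u)\<^sup>2)"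
      proof -
        have "\<epsilon> * 1 \<le> \<epsilon> * (1 + (norm u)\<^sup>2)"
          using \<epsilon> by (intro mult_left_mono) auto
        with \<epsilon> show ?thesis by linarith
      qed
      finally show "\<zeta> (x + z) \<bullet> F x u \<le> - (norm x)\<^sup>2 + \<gamma> * (norm u)\<^sup>2 + \<epsilon> * (1 + (norm u)\<^sup>2)" .
    qed
  qed
qed

section \<open>Interpolation between shells\<close>

text \<open>One truncated square is divided by the sum of two opposed ones, which never vanish
  together. Since the derivative is zero outside \<open>{0..1}\<close>, compactness gives the bound
  \<open>B\<close>.\<close>

lemma C1_cutoff:
  obtains \<eta> \<eta>' :: "real \<Rightarrow> real" and B where
    "\<And>s. (\<eta> has_real_derivative \<eta>' s) (at s)" "continuous_on UNIV \<eta>'"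
    "\<And>s. 0 \<le> \<eta> s" "\<And>s. \<eta> s \<le> 1" "\<And>s. s \<le> 1/3 \<Longrightarrow> \<eta> s = 0" "\<And>s. 2/3 \<le> s \<Longrightarrow> \<eta> s = 1"
    "\<And>s. \<bar>\<eta>' s\<bar> \<le> B"
proof -
  define q where "q = (\<lambda>s::real. (max 0 s)\<^sup>2)"
  define q' where "q' = (\<lambda>s::real. 2 * max 0 s)"
  define d where "d = (\<lambda>s. q (s - 1/3) + q (2/3 - s))"
  define \<eta> where "\<eta> = (\<lambda>s. q (s - 1/3) / d s)"
  define \<eta>' where "\<eta>' = (\<lambda>s.
    (q' (s - 1/3) * d s - q (s - 1/3) * (q' (s - 1/3) - q' (2/3 - s))) / (d s * d s))"
  have q: "(q has_real_derivative q' s) (at s)" for s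
    unfolding q_def q'_def by (rule max_zero_power2_has_derivative)
  have q0: "0 \<le> q s" for s by (simp add: q_def)
  have d: "d s > 0" for s
  proof (cases "s > 1/3")
    case True
    then have "q (s - 1/3) > 0" by (simp add: q_def)
    then show ?thesis using q0[of "2/3 - s"] by (simp add: d_def)
  next
    case False
    then have "q (2/3 - s) > 0" by (simp add: q_def)
    then show ?thesis using q0[of "s - 1/3"] by (simp add: d_def)
  qed
  have ql: "((\<lambda>s. q (s - 1/3)) has_real_derivative q' (s - 1/3)) (at s)" for s
    using DERIV_chain2[OF q DERIV_diff[OF DERIV_ident DERIV_const]] by simp
  have qr: "((\<lambda>s. q (2/3 - s)) has_real_derivative - q' (2/3 - s)) (at s)" for s
    using DERIV_chain2[OF q DERIV_diff[OF DERIV_const DERIV_ident]] by simp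
  have der: "(\<eta> has_real_derivative \<eta>' s) (at s)" for s
  proof -
    have "(d has_real_derivative q' (s - 1/3) - q' (2/3 - s)) (at s)"
      unfolding d_def using DERIV_add[OF ql qr] by simp
    from DERIV_divide[OF ql this] d[of s] show ?thesis by (simp add: \<eta>_def \<eta>'_def)
  qed
  have "continuous_on UNIV d"
    unfolding d_def q_def by (intro continuous_intros)
  then have cont: "continuous_on UNIV \<eta>'"
    unfolding \<eta>'_def using d unfolding q_def q'_def
    by (intro continuous_intros) (auto simp: less_imp_neq[symmetric])
  have "compact (\<eta>' ` {0..1})"
    using continuous_on_subset[OF cont] by (intro compact_continuous_image) auto
  then obtain B where B: "\<And>s. s \<in> {0..1} \<Longrightarrow> \<bar>\<eta>' s\<bar> \<le> B"
    unfolding image_iff by (metis bounded_iff compact_imp_bounded imageI real_norm_def)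
  have "\<bar>\<eta>' s\<bar> \<le> B" for s
  proof (cases "s \<in> {0..1}")
    case False
    then have "\<eta>' s = 0"
    proof (cases "s < 0")
      case True
      then show ?thesis by (simp add: \<eta>'_def q_def q'_def)
    next
      case s: False
      then have "q (2/3 - s) = 0" "q' (2/3 - s) = 0" using False by (auto simp: q_def q'_def)
      then show ?thesis by (simp add: \<eta>'_def d_def)
    qed
    then show ?thesis using B[of 0] by simp
  qed (rule B)
  moreover have "\<eta> s \<le> 1" for s
    using d[of s] q0[of "2/3 - s"] by (simp add: \<eta>_def d_def)
  moreover have "\<eta> s = 1" if "2/3 \<le> s" for s
  proof -
    have "q (2/3 - s) = 0" using that by (simp add: q_def)
    then show ?thesis using d[of s] by (simp add: \<eta>_def d_def)
  qed
  moreover have "\<eta> s = 0" if "s \<le> 1/3" for s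
    using that by (simp add: \<eta>_def q_def)
  moreover have "0 \<le> \<eta> s" for s
    using d[of s] q0 by (simp add: \<eta>_def)
  ultimately show thesis using der cont that by blast
qed

section \<open>Logarithmic radius and gluing of consecutive pieces\<close>

lemma ln_norm_has_derivative:
  fixes x :: "'a::euclidean_space"
  assumes "x \<noteq> 0"
  shows "((\<lambda>x. ln (norm x)) has_derivative (\<lambda>h. (x \<bullet> h) / (norm x)\<^sup>2)) (at x)"
proof -
  have "((\<lambda>x. ln (norm x)) has_derivative (\<lambda>h. (h \<bullet> sgn x) * inverse (norm x))) (at x)"
    using assms by (intro has_derivative_ln has_derivative_norm) auto
  then show ?thesis
    by (simp add: sgn_div_norm power2_eq_square divide_inverse inner_commute mult_ac)
qed

text \<open>The cut-off is hidden: \<open>t\<close> is its value and \<open>m\<close> its derivative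
  with respect to \<open>ln (norm x)\<close>, whose gradient accounts for
  \<open>(x \<bullet> v) / (norm x)\<^sup>2\<close>. The exponents \<open>k - 1\<close> and
  \<open>k + 2\<close> are a coarse enclosure of the region where pieces \<open>k\<close> and
  \<open>k + 1\<close> are mixed.\<close>

definition interpolates ::
    "real \<Rightarrow> (int \<Rightarrow> 'a::euclidean_space \<Rightarrow> real) \<Rightarrow> (int \<Rightarrow> 'a \<Rightarrow> 'a \<Rightarrow>\<^sub>L real) \<Rightarrow>
      ('a \<Rightarrow> real) \<Rightarrow> ('a \<Rightarrow> 'a \<Rightarrow>\<^sub>L real) \<Rightarrow> bool" where
  "interpolates B Vk Vk' W W' \<longleftrightarrow>
     (\<forall>x. x \<noteq> 0 \<longrightarrow> (\<exists>(k::int) t m. exp (real_of_int k - 1) \<le> norm x \<and> norm x \<le> exp (real_of_int k + 2) \<and>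
        0 \<le> t \<and> t \<le> 1 \<and> \<bar>m\<bar> \<le> B \<and> W x = (1 - t) * Vk k x + t * Vk (k + 1) x \<and>
        (\<forall>v. W' x v = (1 - t) * Vk' k x v + t * Vk' (k + 1) x v +
           m * ((x \<bullet> v) / (norm x)\<^sup>2) * (Vk (k + 1) x - Vk k x))))"

text \<open>
  Interpolation with a cut-off that is constant near both ends, so that the pieces for consecutive
  indices \<open>k\<close> agree where their domains overlap.
\<close>

lemma C1_interpolation_over_shells:
  "\<exists>B\<ge>0. \<forall>(Vk :: int \<Rightarrow> 'a::euclidean_space \<Rightarrow> real) Vk'. (\<forall>k. C1_on (Vk k) (Vk' k) UNIV) \<longrightarrow>
     (\<exists>W W'. W 0 = 0 \<and> C1_on W W' (UNIV - {0}) \<and> interpolates B Vk Vk' W W')"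
proof -
  obtain \<eta> \<eta>' :: "real \<Rightarrow> real" and B where \<eta>:
    "\<And>s. (\<eta> has_real_derivative \<eta>' s) (at s)" "continuous_on UNIV \<eta>'"
    "\<And>s. 0 \<le> \<eta> s" "\<And>s. \<eta> s \<le> 1" "\<And>s. s \<le> 1/3 \<Longrightarrow> \<eta> s = 0" "\<And>s. 2/3 \<le> s \<Longrightarrow> \<eta> s = 1"
    "\<And>s. \<bar>\<eta>' s\<bar> \<le> B"
    using C1_cutoff by blast
  have cont_\<eta>: "continuous_on UNIV \<eta>"
    using \<eta>(1) by (metis DERIV_isCont continuous_at_imp_continuous_on)
  show ?thesis
  proof (intro exI[of _ B] conjI allI impI)
    show "B \<ge> 0" using \<eta>(7)[of 0] by linarith
    fix Vk :: "int \<Rightarrow> 'a \<Rightarrow> real" and Vk' :: "int \<Rightarrow> 'a \<Rightarrow> 'a \<Rightarrow>\<^sub>L real"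
    assume "\<forall>k. C1_on (Vk k) (Vk' k) UNIV"
    then have Vk: "C1_on (Vk k) (Vk' k) UNIV" for k by blast
    define s where "s = (\<lambda>x::'a. ln (norm x))"
    define \<Phi> where "\<Phi> = (\<lambda>(k::int) x. (1 - \<eta> (s x - k)) * Vk k x + \<eta> (s x - k) * Vk (k + 1) x)"
    define \<Phi>' where "\<Phi>' = (\<lambda>(k::int) x. (1 - \<eta> (s x - k)) *\<^sub>R Vk' k x + \<eta> (s x - k) *\<^sub>R Vk' (k + 1) x
      + (\<eta>' (s x - k) / (norm x)\<^sup>2 * (Vk (k + 1) x - Vk k x)) *\<^sub>R blinfun_inner_right x)"
    define W where "W = (\<lambda>x. if x = 0 then 0 else \<Phi> \<lfloor>s x\<rfloor> x)"
    \<comment> \<open>The region with floor \<open>k\<close> is widened by 1/3 on both sides; the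
      result is open and matches the intervals on which the cut-off is constant.\<close>
    define U where "U = (\<lambda>k::int. {x::'a. exp (real_of_int k - 1/3) < norm x \<and> norm x < exp (real_of_int k + 4/3)})"
    have openU: "open (U k)" for k
      unfolding U_def by (intro open_Collect_conj open_Collect_less continuous_intros)
    have U: "x \<noteq> 0" "k - 1/3 < s x" "s x < k + 4/3" if "x \<in> U k" for x k
    proof -
      have "exp (real_of_int k - 1/3) < norm x" "norm x < exp (real_of_int k + 4/3)" using that by (auto simp: U_def)
      moreover from this(1) show "x \<noteq> 0" by auto
      then have "norm x = exp (s x)" by (simp add: s_def)
      ultimately show "k - 1/3 < s x" "s x < k + 4/3"
        by simp_all
    qed
    have inU: "x \<in> U \<lfloor>s x\<rfloor>" if "x \<noteq> 0" for x
    proof -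
      have "norm x = exp (s x)" using that by (simp add: s_def)
      moreover have "of_int \<lfloor>s x\<rfloor> - 1/3 < s x" "s x < of_int \<lfloor>s x\<rfloor> + 4/3" by linarith+
      ultimately show ?thesis by (simp add: U_def)
    qed
    have C1: "C1_on (\<Phi> k) (\<Phi>' k) (U k)" for k
      unfolding C1_on_def
    proof (intro conjI ballI)
      fix x assume x: "x \<in> U k"
      have ds: "((\<lambda>x. s x - k) has_derivative (\<lambda>h. (x \<bullet> h) / (norm x)\<^sup>2)) (at x)"
        unfolding s_def using has_derivative_diff[OF ln_norm_has_derivative[OF U(1)[OF x]] has_derivative_const]
        by simp
      have d\<eta>: "((\<lambda>x. \<eta> (s x - k)) has_derivative (\<lambda>h. \<eta>' (s x - k) * ((x \<bullet> h) / (norm x)\<^sup>2))) (at x)"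
        using has_derivative_compose[OF ds \<eta>(1)[unfolded has_field_derivative_def]] by simp
      have "(\<Phi> k has_derivative (\<lambda>h.
          ((1 - \<eta> (s x - k)) * Vk' k x h + (0 - \<eta>' (s x - k) * ((x \<bullet> h) / (norm x)\<^sup>2)) * Vk k x)
          + (\<eta> (s x - k) * Vk' (k + 1) x h + \<eta>' (s x - k) * ((x \<bullet> h) / (norm x)\<^sup>2) * Vk (k + 1) x)))
          (at x)"
        unfolding \<Phi>_def
        by (intro has_derivative_add has_derivative_mult has_derivative_diff has_derivative_const d\<eta>
            C1_onD[OF Vk UNIV_I])
      moreover have "\<Phi>' k x h = (1 - \<eta> (s x - k)) * Vk' k x h + \<eta> (s x - k) * Vk' (k + 1) x h
          + \<eta>' (s x - k) / (norm x)\<^sup>2 * (Vk (k + 1) x - Vk k x) * (x \<bullet> h)" for h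
        by (simp add: \<Phi>'_def plus_blinfun.rep_eq scaleR_blinfun.rep_eq)
      ultimately show "(\<Phi> k has_derivative blinfun_apply (\<Phi>' k x)) (at x)"
        by (elim has_derivative_eq_rhs) (simp add: fun_eq_iff algebra_simps diff_divide_distrib)
    next
      have s: "continuous_on (U k) (\<lambda>x. s x - k)"
        unfolding s_def using U(1) by (intro continuous_intros) auto
      have "continuous_on (U k) (Vk j)" for j
        using C1_onD[OF Vk UNIV_I] by (meson continuous_at_imp_continuous_on has_derivative_continuous)
      moreover have "continuous_on (U k) (Vk' j)" for j
        using Vk[of j] continuous_on_subset[of UNIV] by (auto simp: C1_on_def)
      moreover have "continuous_on (U k) (\<lambda>x. \<eta> (s x - k))"
        by (rule continuous_on_compose2[OF cont_\<eta> s]) auto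
      moreover have "continuous_on (U k) (\<lambda>x. \<eta>' (s x - k))"
        by (rule continuous_on_compose2[OF \<eta>(2) s]) auto
      moreover have "\<forall>x\<in>U k. (norm x)\<^sup>2 \<noteq> 0" using U(1) by simp
      ultimately show "continuous_on (U k) (\<Phi>' k)"
        unfolding \<Phi>'_def
        by (intro continuous_on_add continuous_on_scaleR continuous_on_mult continuous_on_divide
            continuous_on_diff continuous_on_const continuous_on_power continuous_on_norm
            bounded_linear.continuous_on[OF bounded_linear_blinfun_inner_right] continuous_on_id)
    qed
    \<comment> \<open>Where \<open>U k\<close> meets the region of the preceding index, both
      formulas reduce to \<open>Vk k\<close>; towards the following index both reduce to
      \<open>Vk (k + 1)\<close>.\<close>
    have W_eq: "W x = \<Phi> k x" if x: "x \<in> U k" for x k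
    proof -
      consider "\<lfloor>s x\<rfloor> = k - 1" | "\<lfloor>s x\<rfloor> = k" | "\<lfloor>s x\<rfloor> = k + 1"
        using U(2,3)[OF x] by linarith
      then show ?thesis
      proof cases
        case 1
        then have "s x - k \<le> 1/3" "2/3 \<le> s x - (k - 1)" using U(2,3)[OF x] by linarith+
        then show ?thesis using 1 U(1)[OF x] \<eta>(5,6) by (simp add: W_def \<Phi>_def)
      next
        case 2
        then show ?thesis using U(1)[OF x] by (simp add: W_def)
      next
        case 3
        then have "2/3 \<le> s x - k" "s x - (k + 1) \<le> 1/3" using U(2,3)[OF x] by linarith+
        then show ?thesis using 3 U(1)[OF x] \<eta>(5,6) by (simp add: W_def \<Phi>_def)
      qed
    qed
    have C1W: "C1_on W (\<Phi>' k) (U k)" for k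
      unfolding C1_on_def
    proof (intro conjI ballI)
      show "continuous_on (U k) (\<Phi>' k)" using C1[of k] by (simp add: C1_on_def)
      show "(W has_derivative blinfun_apply (\<Phi>' k x)) (at x)" if "x \<in> U k" for x
        by (rule has_derivative_transform_within_open[OF C1_onD[OF C1 that] openU that])
          (simp add: W_eq)
    qed
    obtain W' where W': "C1_on W W' (UNIV - {0})"
      using C1_on_glue[of "UNIV - {0}" W] openU inU C1W by (metis DiffD2 insertCI)
    show "\<exists>W W'. W 0 = 0 \<and> C1_on W W' (UNIV - {0}) \<and> interpolates B Vk Vk' W W'"
      unfolding interpolates_def
    proof (intro exI[of _ W] exI[of _ W'] conjI allI impI W')
      show "W 0 = 0" by (simp add: W_def)
      fix x :: 'a assume x: "x \<noteq> 0"
      define k where "k = \<lfloor>s x\<rfloor>"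
      have xU: "x \<in> U k" using inU[OF x] by (simp add: k_def)
      have "W' x = \<Phi>' k x"
        using C1_on_unique[OF W' C1W _ xU] x by simp
      then have W'x: "W' x v = (1 - \<eta> (s x - k)) * Vk' k x v + \<eta> (s x - k) * Vk' (k + 1) x v +
              \<eta>' (s x - k) * ((x \<bullet> v) / (norm x)\<^sup>2) * (Vk (k + 1) x - Vk k x)" for v
        by (simp add: \<Phi>'_def plus_blinfun.rep_eq scaleR_blinfun.rep_eq)
      have "exp (real_of_int k - 1) \<le> exp (real_of_int k - 1/3 )" "exp (real_of_int k + 4/3 ) \<le> exp (real_of_int k + 2)" by simp_all
      then have "exp (real_of_int k - 1) \<le> norm x" "norm x \<le> exp (real_of_int k + 2)"
        using xU unfolding U_def mem_Collect_eq by linarith+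
      then show "\<exists>(k::int) t m. exp (real_of_int k - 1) \<le> norm x \<and> norm x \<le> exp (real_of_int k + 2) \<and> 0 \<le> t \<and> t \<le> 1 \<and>
           \<bar>m\<bar> \<le> B \<and> W x = (1 - t) * Vk k x + t * Vk (k + 1) x \<and>
           (\<forall>v. W' x v = (1 - t) * Vk' k x v + t * Vk' (k + 1) x v +
              m * ((x \<bullet> v) / (norm x)\<^sup>2) * (Vk (k + 1) x - Vk k x))"
        using \<eta>(3,4,7) W'x W_eq[OF xU]
        by (intro exI[of _ k] exI[of _ "\<eta> (s x - k)"] exI[of _ "\<eta>' (s x - k)"]) (auto simp: \<Phi>_def)
    qed
  qed
qed

text \<open>On each compact shell the positive continuous tolerance \<open>\<tau>\<close> has a
  positive lower bound, which serves as accuracy of that piece. The factor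
  \<open>min 1 ((norm x)\<^sup>2)\<close> keeps the error below \<open>c\<close> times the sum of
  the squared norms of state and input; closeness relative to \<open>V\<close> will preserve
  definiteness and properness.\<close>

lemma smooth_approximation_off_origin:
  fixes F :: "'a::euclidean_space \<Rightarrow> 'u::euclidean_space \<Rightarrow> 'a"
  assumes V: "V \<in> storage_functions F \<gamma>" and Vpos: "\<And>x. x \<noteq> 0 \<Longrightarrow> 0 < V x" and V_0: "V 0 = 0"
    and F: "Lipschitz_on_bounded F"
    and l: "continuous_on UNIV l" "\<And>x u. norm (F x u) \<le> l x * (1 + norm u)"
    and c: "0 < c"
  obtains W W' where "C1_on W W' (UNIV - {0})"
    "\<And>x. \<bar>W x - V x\<bar> \<le> V x / 2"
    "\<And>x u. x \<noteq> 0 \<Longrightarrow> W' x (F x u) \<le>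
       - (norm x)\<^sup>2 + \<gamma> * (norm u)\<^sup>2 + c * min 1 ((norm x)\<^sup>2) * (1 + (norm u)\<^sup>2)"
proof -
  \<comment> \<open>\<open>B\<close> is fixed before the pieces are constructed, as their accuracy
    depends on it.\<close>
  obtain B where "B \<ge> 0" and B:
    "\<forall>(Vk :: int \<Rightarrow> 'a \<Rightarrow> real) Vk'. (\<forall>k. C1_on (Vk k) (Vk' k) UNIV) \<longrightarrow>
      (\<exists>W W'. W 0 = 0 \<and> C1_on W W' (UNIV - {0}) \<and> interpolates B Vk Vk' W W')"
    using C1_interpolation_over_shells by (elim exE conjE)
  have l0: "0 \<le> l x" for x
    using l(2)[of x 0] norm_ge_zero[of "F x 0"] by (simp del: norm_ge_zero)
  \<comment> \<open>\<open>\<kappa>\<close> is the amplification of the tolerance by the derivative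
    of the cut-off. Two pieces differ by at most \<open>2 * \<tau> x\<close>, and another 2 stems
    from \<open>one_plus_norm_le\<close>, which gives the 4.\<close>
  define \<kappa> where "\<kappa> = (\<lambda>x. 1 + 4 * B * l x / norm x)"
  define \<tau> where "\<tau> = (\<lambda>x. min (V x / 2) (c * min 1 ((norm x)\<^sup>2) / \<kappa> x))"
  have \<kappa>: "1 \<le> \<kappa> x" for x
    using \<open>B \<ge> 0\<close> l0 by (simp add: \<kappa>_def)
  have \<tau>pos: "0 < \<tau> x" if "x \<noteq> 0" for x
    using that Vpos c \<kappa>[of x] by (simp add: \<tau>_def)
  have \<tau>cont: "continuous_on (UNIV - {0}) \<tau>"
  proof -
    have "continuous_on (UNIV - {0}) \<kappa>"
      unfolding \<kappa>_def
      by (intro continuous_intros continuous_on_subset[OF l(1)]) auto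
    moreover have "\<forall>x. \<kappa> x \<noteq> 0" using \<kappa> by (metis not_one_le_zero)
    ultimately show ?thesis
      unfolding \<tau>_def
      by (intro continuous_on_min continuous_on_divide continuous_on_mult continuous_on_power
          continuous_on_norm continuous_on_const continuous_on_id
          continuous_on_subset[OF storage_functionsD(1)[OF V]]) auto
  qed
  have "\<exists>W W'. C1_on W W' UNIV \<and> (\<forall>x. exp (real_of_int k - 2) \<le> norm x \<and> norm x \<le> exp (real_of_int k + 2) \<longrightarrow>
      \<bar>W x - V x\<bar> \<le> \<tau> x \<and>
      (\<forall>u. W' x (F x u) \<le> - (norm x)\<^sup>2 + \<gamma> * (norm u)\<^sup>2 + \<tau> x * (1 + (norm u)\<^sup>2)))" for k :: int
  proof -
    define S where "S = {x::'a. exp (real_of_int k - 2) \<le> norm x \<and> norm x \<le> exp (real_of_int k + 2)}"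
    have S0: "x \<noteq> 0" if "x \<in> S" for x using that by (auto simp: S_def)
    have "S = cball 0 (exp (real_of_int k + 2)) - ball 0 (exp (real_of_int k - 2))"
      by (auto simp: S_def)
    then have "compact S" by (simp add: compact_diff)
    have "\<exists>\<epsilon>>0. \<forall>x\<in>S. \<epsilon> \<le> \<tau> x"
    proof (cases "S = {}")
      case True
      then show ?thesis using zero_less_one by blast
    next
      case False
      have "continuous_on S \<tau>" by (rule continuous_on_subset[OF \<tau>cont]) (auto dest: S0)
      then obtain x where "x \<in> S" "\<And>y. y \<in> S \<Longrightarrow> \<tau> x \<le> \<tau> y"
        using continuous_attains_inf[OF \<open>compact S\<close> False] by blast
      then show ?thesis using \<tau>pos[OF S0] by blast
    qed
    then obtain \<epsilon> where \<epsilon>: "0 < \<epsilon>" "\<And>x. x \<in> S \<Longrightarrow> \<epsilon> \<le> \<tau> x" by blast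
    obtain W W' where W: "C1_on W W' UNIV"
      "\<And>x. exp (real_of_int k - 2) \<le> norm x \<Longrightarrow> norm x \<le> exp (real_of_int k + 2) \<Longrightarrow> \<bar>W x - V x\<bar> \<le> \<epsilon>"
      "\<And>x u. exp (real_of_int k - 2) \<le> norm x \<Longrightarrow> norm x \<le> exp (real_of_int k + 2) \<Longrightarrow>
         W' x (F x u) \<le> - (norm x)\<^sup>2 + \<gamma> * (norm u)\<^sup>2 + \<epsilon> * (1 + (norm u)\<^sup>2)"
      using smooth_approximation_on_shell[OF V F exp_gt_zero[of "real_of_int k - 2"] \<epsilon>(1),
          of "exp (real_of_int k + 2)"] by blast
    show ?thesis
    proof (intro exI[of _ W] exI[of _ W'] conjI allI impI W(1))
      fix x :: 'a assume x: "exp (real_of_int k - 2) \<le> norm x \<and> norm x \<le> exp (real_of_int k + 2)"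
      then have le: "\<epsilon> \<le> \<tau> x" using \<epsilon>(2) by (simp add: S_def)
      then show "\<bar>W x - V x\<bar> \<le> \<tau> x" using W(2)[of x] x by simp
      fix u :: 'u
      have "\<epsilon> * (1 + (norm u)\<^sup>2) \<le> \<tau> x * (1 + (norm u)\<^sup>2)"
        using le by (intro mult_right_mono) auto
      then show "W' x (F x u) \<le> - (norm x)\<^sup>2 + \<gamma> * (norm u)\<^sup>2 + \<tau> x * (1 + (norm u)\<^sup>2)"
        using W(3)[of x u] x by linarith
    qed
  qed
  then obtain Vk Vk' where Vk: "\<And>k::int. C1_on (Vk k) (Vk' k) UNIV"
    and close: "\<And>(k::int) x. exp (real_of_int k - 2) \<le> norm x \<Longrightarrow> norm x \<le> exp (real_of_int k + 2) \<Longrightarrow>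
      \<bar>Vk k x - V x\<bar> \<le> \<tau> x"
    and diss: "\<And>(k::int) x u. exp (real_of_int k - 2) \<le> norm x \<Longrightarrow> norm x \<le> exp (real_of_int k + 2) \<Longrightarrow>
      Vk' k x (F x u) \<le> - (norm x)\<^sup>2 + \<gamma> * (norm u)\<^sup>2 + \<tau> x * (1 + (norm u)\<^sup>2)"
    by metis
  from B Vk obtain W W' where "W 0 = 0" "C1_on W W' (UNIV - {0})" and W: "interpolates B Vk Vk' W W'"
    by metis
  have "\<bar>W x - V x\<bar> \<le> V x / 2 \<and> (\<forall>u. W' x (F x u) \<le>
      - (norm x)\<^sup>2 + \<gamma> * (norm u)\<^sup>2 + c * min 1 ((norm x)\<^sup>2) * (1 + (norm u)\<^sup>2))" if x: "x \<noteq> 0" for x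
  proof (intro conjI allI)
    obtain k :: int and t m where k: "exp (real_of_int k - 1) \<le> norm x" "norm x \<le> exp (real_of_int k + 2)"
      and t: "0 \<le> t" "t \<le> 1" and m: "\<bar>m\<bar> \<le> B" and Wx: "W x = (1 - t) * Vk k x + t * Vk (k + 1) x"
      and W'x: "\<And>v. W' x v = (1 - t) * Vk' k x v + t * Vk' (k + 1) x v +
              m * ((x \<bullet> v) / (norm x)\<^sup>2) * (Vk (k + 1) x - Vk k x)"
      using W x unfolding interpolates_def by metis
    \<comment> \<open>Pieces \<open>k\<close> and \<open>k + 1\<close> are accurate for logarithmic
      radii from \<open>k - 2\<close> to \<open>k + 2\<close> and from \<open>k - 1\<close> to
      \<open>k + 3\<close>; the point lies in both ranges.\<close>
    have range: "exp (real_of_int k - 2) \<le> norm x" "exp (real_of_int (k + 1) - 2) \<le> norm x"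
        "norm x \<le> exp (real_of_int (k + 1) + 2)"
      by (rule order_trans[OF _ k(1)], simp, rule order_trans[OF _ k(1)], simp,
          rule order_trans[OF k(2)], simp)
    note close_k = close[OF range(1) k(2)] and close_Suc = close[OF range(2,3)]
    have "W x - V x = (1 - t) * (Vk k x - V x) + t * (Vk (k + 1) x - V x)"
      unfolding Wx by (simp add: algebra_simps)
    also have "\<bar>\<dots>\<bar> \<le> (1 - t) * \<bar>Vk k x - V x\<bar> + t * \<bar>Vk (k + 1) x - V x\<bar>"
      using t abs_triangle_ineq[of "(1 - t) * (Vk k x - V x)" "t * (Vk (k + 1) x - V x)"]
      by (simp add: abs_mult)
    also have "\<dots> \<le> \<tau> x"
      using t close_k close_Suc by (intro convex_bound_le) auto
    also have "\<dots> \<le> V x / 2" unfolding \<tau>_def by (rule min.cobounded1)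
    finally show "\<bar>W x - V x\<bar> \<le> V x / 2" .
    fix u :: 'u
    define X where "X = - (norm x)\<^sup>2 + \<gamma> * (norm u)\<^sup>2 + \<tau> x * (1 + (norm u)\<^sup>2)"
    have convex: "(1 - t) * Vk' k x (F x u) + t * Vk' (k + 1) x (F x u) \<le> X"
      using t diss[OF range(1) k(2)] diss[OF range(2,3)]
      by (intro convex_bound_le) (auto simp: X_def)
    have "\<bar>x \<bullet> F x u / (norm x)\<^sup>2\<bar> \<le> norm x * norm (F x u) / (norm x)\<^sup>2"
      using Cauchy_Schwarz_ineq2[of x "F x u"] by (simp add: divide_right_mono)
    also have "\<dots> = norm (F x u) / norm x"
      using x by (simp add: power2_eq_square)
    also have "\<dots> \<le> l x * (2 * (1 + (norm u)\<^sup>2)) / norm x"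
      using order_trans[OF l(2) mult_left_mono[OF one_plus_norm_le l0]] by (simp add: divide_right_mono)
    finally have "\<bar>m\<bar> * \<bar>x \<bullet> F x u / (norm x)\<^sup>2\<bar> * \<bar>Vk (k + 1) x - Vk k x\<bar>
        \<le> B * (l x * (2 * (1 + (norm u)\<^sup>2)) / norm x) * (2 * \<tau> x)"
      using m close_k close_Suc \<open>B \<ge> 0\<close> l0[of x] by (intro mult_mono) (auto intro!: mult_nonneg_nonneg divide_nonneg_nonneg)
    then have "m * ((x \<bullet> F x u) / (norm x)\<^sup>2) * (Vk (k + 1) x - Vk k x)
        \<le> B * (l x * (2 * (1 + (norm u)\<^sup>2)) / norm x) * (2 * \<tau> x)"
      unfolding abs_mult[symmetric] by (rule order_trans[OF abs_ge_self])
    with convex have "W' x (F x u) \<le> X + B * (l x * (2 * (1 + (norm u)\<^sup>2)) / norm x) * (2 * \<tau> x)"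
      unfolding W'x by linarith
    also have "\<dots> = - (norm x)\<^sup>2 + \<gamma> * (norm u)\<^sup>2 + (\<tau> x * \<kappa> x) * (1 + (norm u)\<^sup>2)"
      unfolding X_def \<kappa>_def by (simp add: algebra_simps add_divide_distrib)
    also have "\<tau> x * \<kappa> x \<le> c * min 1 ((norm x)\<^sup>2)"
    proof -
      have "\<tau> x \<le> c * min 1 ((norm x)\<^sup>2) / \<kappa> x" unfolding \<tau>_def by (rule min.cobounded2)
      then show ?thesis using \<kappa>[of x] by (subst (asm) pos_le_divide_eq) auto
    qed
    finally show "W' x (F x u) \<le>
       - (norm x)\<^sup>2 + \<gamma> * (norm u)\<^sup>2 + c * min 1 ((norm x)\<^sup>2) * (1 + (norm u)\<^sup>2)"
      by (simp add: mult_right_mono)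
  qed
  moreover have "\<bar>W 0 - V 0\<bar> \<le> V 0 / 2" using \<open>W 0 = 0\<close> V_0 by simp
  ultimately show thesis using \<open>C1_on W W' (UNIV - {0})\<close> that by metis
qed

text \<open>An arbitrarily small increase of the gain buys smoothness: the approximation error is
  absorbed by rescaling. As \<open>W\<close> lies between \<open>V / 2\<close> and
  \<open>3 / 2 * V\<close>, it inherits continuity at the origin, definiteness and
  properness.\<close>

lemma C1_proper_storage_function:
  fixes F :: "'a::euclidean_space \<Rightarrow> 'u::euclidean_space \<Rightarrow> 'a"
  assumes V: "V \<in> proper_storage_functions F \<gamma>" and \<gamma>: "0 \<le> \<gamma>" "\<gamma> < \<gamma>'"
    and F: "Lipschitz_on_bounded F"
    and l: "continuous_on UNIV l" "\<And>x u. norm (F x u) \<le> l x * (1 + norm u)"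
  shows "proper_storage_functions F \<gamma>' \<inter> C1_off_origin \<noteq> {}"
proof -
  have Vs: "V \<in> storage_functions F \<gamma>" and proper: "proper_fun V" and V0: "\<And>x. V x = 0 \<longleftrightarrow> x = 0"
    using V by (auto simp: proper_storage_functions_def positive_definite_fun_def)
  note contV = storage_functionsD(1)[OF Vs]
  have Vpos: "0 < V x" if "x \<noteq> 0" for x
    using storage_functionsD(2)[OF Vs, of x] V0[of x] that by simp
  \<comment> \<open>\<open>c\<close> is the solution of
    \<open>(\<gamma> + c) / (1 - c) = \<gamma>'\<close>, and \<open>\<mu>\<close> is then
    \<open>1 / (1 - c)\<close>.\<close>
  define c where "c = (\<gamma>' - \<gamma>) / (1 + \<gamma>')"
  define \<mu> where "\<mu> = (1 + \<gamma>') / (1 + \<gamma>)"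
  have c: "0 < c" "0 < \<mu>" "\<mu> * (1 - c) = 1" "\<mu> * (\<gamma> + c) = \<gamma>'"
  proof -
    have pos: "0 < 1 + \<gamma>'" "0 < 1 + \<gamma>" using \<gamma> by auto
    show "0 < c" "0 < \<mu>" using \<gamma> pos by (auto simp: c_def \<mu>_def)
    have "1 - c = (1 + \<gamma>) / (1 + \<gamma>')" "\<gamma> + c = \<gamma>' * ((1 + \<gamma>) / (1 + \<gamma>'))"
      using pos by (simp_all add: c_def field_simps)
    then show "\<mu> * (1 - c) = 1" "\<mu> * (\<gamma> + c) = \<gamma>'"
      using pos by (simp_all add: \<mu>_def)
  qed
  have V_0: "V 0 = 0" using V0 by simp
  obtain W W' where C1: "C1_on W W' (UNIV - {0})"
    and close: "\<And>x. \<bar>W x - V x\<bar> \<le> V x / 2"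
    and diss: "\<And>x u. x \<noteq> 0 \<Longrightarrow> W' x (F x u) \<le>
       - (norm x)\<^sup>2 + \<gamma> * (norm u)\<^sup>2 + c * min 1 ((norm x)\<^sup>2) * (1 + (norm u)\<^sup>2)"
    using smooth_approximation_off_origin[OF Vs Vpos V_0 F l c(1)] by blast
  define Z where "Z = (\<lambda>x. \<mu> * W x)"
  define Z' where "Z' = (\<lambda>x. \<mu> *\<^sub>R W' x)"
  have W_bounds: "V x / 2 \<le> W x" "W x \<le> 3 / 2 * V x" for x
    using close[of x] unfolding abs_le_iff by linarith+
  have W0: "W 0 = 0" using close[of 0] V_0 by simp
  have der: "(Z has_derivative blinfun_apply (Z' x)) (at x)" if "x \<noteq> 0" for x
  proof -
    have "(W has_derivative blinfun_apply (W' x)) (at x)" using C1_onD[OF C1] that by simp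
    from has_derivative_mult_right[OF this, of \<mu>] show ?thesis
      by (simp add: Z_def Z'_def scaleR_blinfun.rep_eq)
  qed
  have contZ': "continuous_on (UNIV - {0}) Z'"
    using C1 unfolding Z'_def C1_on_def by (intro continuous_intros) auto
  \<comment> \<open>The derivative gives continuity off the origin only; at the origin
    \<open>W\<close> is squeezed by a multiple of \<open>V\<close>.\<close>
  have contW: "isCont W x" for x
  proof (cases "x = 0")
    case True
    have "(V \<longlongrightarrow> 0) (at 0)"
      using contV V_0 by (metis UNIV_I continuous_on_def)
    then have lim: "((\<lambda>x. 3 / 2 * V x) \<longlongrightarrow> 0) (at 0)" by (rule tendsto_mult_right_zero)
    have "\<bar>W x\<bar> \<le> 3 / 2 * V x" for x
      using W_bounds[of x] storage_functionsD(2)[OF Vs, of x] by linarith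
    then have "(W \<longlongrightarrow> 0) (at 0)"
      by (intro Lim_null_comparison[OF _ lim]) (auto intro!: always_eventually)
    then show ?thesis using True W0 by (simp add: isCont_def)
  next
    case False
    then show ?thesis using C1_onD[OF C1, of x] by (intro has_derivative_continuous) auto
  qed
  then have contZ: "continuous_on UNIV Z"
    unfolding Z_def by (intro continuous_on_mult continuous_on_const continuous_at_imp_continuous_on) auto
  have Z_nonneg: "0 \<le> Z x" for x
    using W_bounds(1)[of x] storage_functionsD(2)[OF Vs, of x] c(2) by (simp add: Z_def)
  have "Z \<in> C1_off_origin"
    unfolding C1_off_origin_def using contZ Z_nonneg der contZ' by blast
  moreover have "Z \<in> storage_functions F \<gamma>'"
    unfolding storage_functions_def mem_Collect_eq
  proof (intro conjI allI ballI impI contZ Z_nonneg)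
    fix x u \<zeta> assume \<zeta>: "\<zeta> \<in> viscosity_subdifferential Z x" and x: "x \<noteq> 0"
    have "\<zeta> \<bullet> F x u \<le> Z' x (F x u)"
      by (rule viscosity_subdifferential_le_derivative[OF der[OF x] \<zeta>])
    also have "\<dots> = \<mu> * W' x (F x u)" by (simp add: Z'_def scaleR_blinfun.rep_eq)
    also have "\<dots> \<le> \<mu> * (- (norm x)\<^sup>2 + \<gamma> * (norm u)\<^sup>2 + (c * (norm x)\<^sup>2 + c * (norm u)\<^sup>2))"
    proof (rule mult_left_mono)
      \<comment> \<open>The minimum is bounded by the squared norm in the first summand and by 1 in
        the second.\<close>
      have "min 1 ((norm x)\<^sup>2) * (1 + (norm u)\<^sup>2) \<le> (norm x)\<^sup>2 + 1 * (norm u)\<^sup>2"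
        unfolding distrib_left by (intro add_mono mult_right_mono) auto
      then have "c * (min 1 ((norm x)\<^sup>2) * (1 + (norm u)\<^sup>2)) \<le> c * ((norm x)\<^sup>2 + 1 * (norm u)\<^sup>2)"
        using c(1) by (intro mult_left_mono) auto
      then show "W' x (F x u) \<le> - (norm x)\<^sup>2 + \<gamma> * (norm u)\<^sup>2 + (c * (norm x)\<^sup>2 + c * (norm u)\<^sup>2)"
        using diss[OF x, of u] by (simp add: algebra_simps)
    qed (use c(2) in simp)
    also have "\<dots> = - (\<mu> * (1 - c)) * (norm x)\<^sup>2 + (\<mu> * (\<gamma> + c)) * (norm u)\<^sup>2"
      by (simp add: algebra_simps)
    also have "\<dots> = - (norm x)\<^sup>2 + \<gamma>' * (norm u)\<^sup>2" unfolding c(3,4) by simp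
    finally show "\<zeta> \<bullet> F x u \<le> - (norm x)\<^sup>2 + \<gamma>' * (norm u)\<^sup>2" .
  qed
  moreover have "proper_fun Z"
    unfolding proper_fun_def
  proof (intro allI impI)
    fix a :: real assume "0 < a"
    then have "compact {x. V x \<le> 2 * a / \<mu>}" using proper c(2) by (simp add: proper_fun_def)
    moreover have "closed {x. Z x \<le> a}"
      using contZ by (intro closed_Collect_le continuous_on_const)
    moreover have "V x \<le> 2 * a / \<mu>" if "Z x \<le> a" for x
    proof -
      have "\<mu> * (V x / 2) \<le> \<mu> * W x" using W_bounds(1) c(2) by (intro mult_left_mono) auto
      then have "\<mu> * (V x / 2) \<le> a" using that by (simp add: Z_def)
      then show ?thesis using c(2) by (simp add: field_simps)
    qed
    then have "{x. Z x \<le> a} = {x. V x \<le> 2 * a / \<mu>} \<inter> {x. Z x \<le> a}" by blast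
    ultimately show "compact {x. Z x \<le> a}" using compact_Int_closed by metis
  qed
  moreover have "positive_definite_fun Z"
    unfolding positive_definite_fun_def
  proof
    fix x
    show "Z x = 0 \<longleftrightarrow> x = 0"
      using W_bounds(1)[of x] Vpos[of x] W0 c(2) by (cases "x = 0") (auto simp: Z_def)
  qed
  ultimately show ?thesis by (auto simp: proper_storage_functions_def)
qed

section \<open>Affine systems\<close>

text \<open>Each component of \<open>u\<close> is bounded by \<open>norm u\<close>. Besides giving
  the growth bound, this is applied to differences of systems.\<close>

lemma affine_system_bound:
  "norm (affine_system g\<^sub>0 g x u) \<le> (norm (g\<^sub>0 x) + (\<Sum>i\<in>UNIV. norm (g i x))) * (1 + norm u)"
proof -
  have "norm (affine_system g\<^sub>0 g x u) \<le> norm (g\<^sub>0 x) + (\<Sum>i\<in>UNIV. norm ((u $ i) *\<^sub>R g i x))"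
    unfolding affine_system_def by (intro norm_triangle_le add_left_mono norm_sum)
  also have "(\<Sum>i\<in>UNIV. norm ((u $ i) *\<^sub>R g i x)) \<le> (\<Sum>i\<in>UNIV. norm u * norm (g i x))"
    using component_le_norm_cart[of u] by (intro sum_mono) (simp add: mult_right_mono)
  also have "\<dots> = norm u * (\<Sum>i\<in>UNIV. norm (g i x))" by (simp add: sum_distrib_left)
  also have "norm (g\<^sub>0 x) + \<dots> \<le> (norm (g\<^sub>0 x) + (\<Sum>i\<in>UNIV. norm (g i x))) * (1 + norm u)"
    by (simp add: algebra_simps sum_nonneg)
  finally show ?thesis by simp
qed

lemma locally_lipschitz_cball:
  fixes f :: "'a::euclidean_space \<Rightarrow> 'b::metric_space"
  assumes "locally_lipschitz f"
  obtains L where "L-lipschitz_on (cball 0 R) f"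
  using local_lipschitz_compact_implies_lipschitz[OF
      local_lipschitz_subset[OF assms, of "{0}" "cball 0 R"] compact_cball compact_sing] by auto

text \<open>For fixed \<open>u\<close> the difference is again of affine form, with constant fields,
  so the growth bound doubles as a Lipschitz bound.\<close>

lemma affine_system_diff:
  fixes g\<^sub>0 :: "real^'n \<Rightarrow> real^'n" and g :: "'m::finite \<Rightarrow> real^'n \<Rightarrow> real^'n"
  shows
  "affine_system g\<^sub>0 g x u - affine_system g\<^sub>0 g y u =
     affine_system (\<lambda>_. g\<^sub>0 x - g\<^sub>0 y) (\<lambda>i _. g i x - g i y) x u"
  by (simp add: affine_system_def scaleR_right_diff_distrib sum_subtractf)

lemma affine_system_Lipschitz_on_bounded:
  fixes g\<^sub>0 :: "real^'n \<Rightarrow> real^'n" and g :: "'m::finite \<Rightarrow> real^'n \<Rightarrow> real^'n"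
  assumes "locally_lipschitz g\<^sub>0" and "\<And>i. locally_lipschitz (g i)"
  shows "Lipschitz_on_bounded (affine_system g\<^sub>0 g)"
  unfolding Lipschitz_on_bounded_def
proof
  fix R :: real
  obtain L\<^sub>0 where L\<^sub>0: "L\<^sub>0-lipschitz_on (cball 0 R) g\<^sub>0"
    using locally_lipschitz_cball[OF assms(1)] by blast
  have "\<exists>L. L-lipschitz_on (cball 0 R) (g i)" for i
    using locally_lipschitz_cball[OF assms(2)] by blast
  then obtain L where L: "\<And>i. (L i)-lipschitz_on (cball 0 R) (g i)" by metis
  define K where "K = L\<^sub>0 + (\<Sum>i\<in>UNIV. L i)"
  have "0 \<le> K"
    unfolding K_def using lipschitz_on_nonneg[OF L\<^sub>0] lipschitz_on_nonneg[OF L] by (simp add: sum_nonneg)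
  moreover have "norm (affine_system g\<^sub>0 g x u - affine_system g\<^sub>0 g y u) \<le> K * (1 + norm u) * norm (x - y)"
    if "norm x \<le> R" "norm y \<le> R" for x y u
  proof -
    have le: "norm (g\<^sub>0 x - g\<^sub>0 y) \<le> L\<^sub>0 * norm (x - y)" "norm (g i x - g i y) \<le> L i * norm (x - y)"
      for i
      using lipschitz_onD[OF L\<^sub>0, of x y] lipschitz_onD[OF L, of x y i] that by (auto simp: dist_norm)
    have "norm (affine_system g\<^sub>0 g x u - affine_system g\<^sub>0 g y u)
        \<le> (norm (g\<^sub>0 x - g\<^sub>0 y) + (\<Sum>i\<in>UNIV. norm (g i x - g i y))) * (1 + norm u)"
      unfolding affine_system_diff by (rule affine_system_bound)
    also have "\<dots> \<le> (L\<^sub>0 * norm (x - y) + (\<Sum>i\<in>UNIV. L i * norm (x - y))) * (1 + norm u)"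
      using le by (intro mult_right_mono add_mono sum_mono) auto
    also have "\<dots> = K * (1 + norm u) * norm (x - y)"
      unfolding K_def sum_distrib_right[symmetric] by (simp add: algebra_simps)
    finally show ?thesis .
  qed
  ultimately show "\<exists>L\<ge>0. \<forall>x y u. norm x \<le> R \<longrightarrow> norm y \<le> R \<longrightarrow>
      norm (affine_system g\<^sub>0 g x u - affine_system g\<^sub>0 g y u) \<le> L * (1 + norm u) * norm (x - y)"
    by blast
qed

theorem theorem1:
  fixes g\<^sub>0 :: "real^'n \<Rightarrow> real^'n"
    and g :: "'m::finite \<Rightarrow> real^'n \<Rightarrow> real^'n"
  assumes "locally_lipschitz g\<^sub>0"
    and "\<And>i. locally_lipschitz (g i)"
  shows "Inf {ereal \<gamma> | \<gamma>. 0 \<le> \<gamma> \<and> proper_storage_functions (affine_system g\<^sub>0 g) \<gamma> \<noteq> {}}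
       = Inf {ereal \<gamma> | \<gamma>. 0 \<le> \<gamma> \<and>
                proper_storage_functions (affine_system g\<^sub>0 g) \<gamma> \<inter> C1_off_origin \<noteq> {}}"
    (is "Inf ?A = Inf ?B")
proof (rule antisym)
  show "Inf ?A \<le> Inf ?B" by (intro Inf_superset_mono) blast
  have cont: "continuous_on UNIV f" if "locally_lipschitz f" for f :: "real^'n \<Rightarrow> real^'n"
    using local_lipschitz_continuous_on[OF that] by simp
  have smooth: "proper_storage_functions (affine_system g\<^sub>0 g) \<gamma>' \<inter> C1_off_origin \<noteq> {}"
    if "proper_storage_functions (affine_system g\<^sub>0 g) \<gamma> \<noteq> {}" "0 \<le> \<gamma>" "\<gamma> < \<gamma>'" for \<gamma> \<gamma>'
  proof -
    obtain V where "V \<in> proper_storage_functions (affine_system g\<^sub>0 g) \<gamma>" using \<open>_ \<noteq> {}\<close> by blast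
    then show ?thesis
      using that(2,3) affine_system_Lipschitz_on_bounded[OF assms] _ affine_system_bound
    proof (rule C1_proper_storage_function)
      show "continuous_on UNIV (\<lambda>x. norm (g\<^sub>0 x) + (\<Sum>i\<in>UNIV. norm (g i x)))"
        using cont assms by (intro continuous_on_add continuous_on_sum continuous_on_norm) auto
    qed
  qed
  \<comment> \<open>A gain \<open>\<gamma>\<close> in the first set puts \<open>\<gamma> + e\<close>
    into the second for every \<open>e > 0\<close>, which suffices for the infima. If the first set
    is empty, its infimum is infinite and nothing is to be shown.\<close>
  show "Inf ?B \<le> Inf ?A"
  proof (rule Inf_greatest)
    fix y assume "y \<in> ?A"
    then obtain \<gamma> where \<gamma>: "y = ereal \<gamma>" "0 \<le> \<gamma>" "proper_storage_functions (affine_system g\<^sub>0 g) \<gamma> \<noteq> {}"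
      by blast
    show "Inf ?B \<le> y"
      unfolding \<gamma>(1)
    proof (rule ereal_le_epsilon2)
      fix e :: real assume "0 < e"
      then have "ereal (\<gamma> + e) \<in> ?B" using smooth[OF \<gamma>(3,2), of "\<gamma> + e"] \<gamma>(2) by auto
      then show "Inf ?B \<le> ereal \<gamma> + ereal e" by (simp add: Inf_lower)
    qed
  qed
qed

end
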